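(* Let $G$ be a finite abelian group of order $n$, let $\chi_1,\dots,\chi_n$ be its distinct characters with $\chi_1$ principal, and let $\Gamma=\mathrm{BiCay}(G;R,L,T)$. Let $\lambda_1,\dots,\lambda_{2n}$ be as in the context, and put $M=\gcd(\lambda_2-\lambda_{2k}\mid 1\le k\le n)$ and $M_T=\gcd(|\chi_k(T)|\mid 1\le k\le n)$. Let $g_p,g_q\in G$, and consider a pair of vertices lying in different parts, namely $((g_p)_0,(g_q)_1)$ or $((g_p)_1,(g_q)_0)$. Then $\Gamma$ has perfect state transfer between these two vertices at time $t$ if and only if all of the following hold: 1) $\Gamma$ is an integral graph and $R=L$; 2) for each $1\le k\le n$: 2.1) $\chi_k(g_pg_q^{-1})=\frac{|\chi_k(T)|}{\chi_k(T)}$ if $\exp(\mathrm{i}t(\lambda_2-\lambda_{2k}))=1$, and $\chi_k(g_pg_q^{-1})=-\frac{|\chi_k(T)|}{\chi_k(T)}$ if $\exp(\mathrm{i}t(\lambda_2-\lambda_{2k}))=-1$; 2.2) $\chi_k(T)\neq 0$; 2.3) $v_2(|\chi_k(T)|)=v_2(|T|)$; 3) if $M>0$, then $v_2(M)>v_2(|T|)$; 4) $t\in\{\frac{(1+2z)\pi}{\gcd(2M_T,M)}\mid z\in\mathbb{Z}\}$.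
   Context: For a subset $S$ of a finite abelian group $G$ and a character $\chi$ of $G$, write $\chi(S)=\sum_{s\in S}\chi(s)$ (so $\chi(\emptyset)=0$). Given subsets $R,L,T\subseteq G$ with $R=R^{-1}$, $L=L^{-1}$ and the identity not in $R\cup L$, the bi-Cayley graph $\mathrm{BiCay}(G;R,L,T)$ has vertex set $G_0\cup G_1$ where $G_i=\{g_i\mid g\in G\}$ are two disjoint copies of $G$, and edges $\{h_0,g_0\}$ when $gh^{-1}\in R$, $\{h_1,g_1\}$ when $gh^{-1}\in L$, and $\{h_0,g_1\}$ when $gh^{-1}\in T$. For $1\le k\le n$ define $\lambda_{2k-1}=\frac{\chi_k(R)+\chi_k(L)-\sqrt{(\chi_k(R)-\chi_k(L))^2+4|\chi_k(T)|^2}}{2}$ and $\lambda_{2k}=\frac{\chi_k(R)+\chi_k(L)+\sqrt{(\chi_k(R)-\chi_k(L))^2+4|\chi_k(T)|^2}}{2}$; these are the eigenvalues of the adjacency matrix $D$ of $\Gamma$. For a graph with adjacency matrix $A$, the transfer matrix is $H(t)=\exp(-\mathrm{i}tA)$, and $\Gamma$ has perfect state transfer (PST) between vertices $u,v$ at time $t\in\mathbb{R}$ if $|H_{u,v}(t)|=1$. A graph is integral if all its adjacency eigenvalues are integers. $v_2$ denotes the 2-adic valuation on $\mathbb{Q}$, with $v_2(0)=\infty$. Gcd's are of nonnegative integers, with $\gcd(a,0)=a$.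
   Formalization: For the pair ((g_p)_1,(g_q)_0), condition 2.1 is proved with χ_k(g_q g_p^{-1}) in place of χ_k(g_p g_q^{-1}); as printed it fails for that pair, e.g. G=Z_3=<a>, R=L=∅, T={a}, g_p=a, g_q=1, t=π/2. *)

theory Defs
  imports "HOL-Analysis.Analysis"
begin

text \<open>
  The finite abelian group \<open>G\<close> is a type of class \<open>finite\<close> and \<open>ab_group_add\<close>, so it is written
  additively: \<open>g h\<^sup>-\<^sup>1\<close> becomes \<open>g - h\<close>, the identity becomes \<open>0\<close> and \<open>R = R\<^sup>-\<^sup>1\<close> becomes
  \<open>uminus ` R = R\<close>. The two copies \<open>g\<^sub>0\<close> and \<open>g\<^sub>1\<close> of \<open>g\<close> are \<open>Inl g\<close> and \<open>Inr g\<close>.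
\<close>

definition character :: "('a::ab_group_add \<Rightarrow> complex) \<Rightarrow> bool" where
  "character c \<longleftrightarrow> (\<forall>g. c g \<noteq> 0) \<and> (\<forall>g h. c (g + h) = c g * c h)"

definition char_sum :: "('a \<Rightarrow> complex) \<Rightarrow> 'a set \<Rightarrow> complex" where
  "char_sum c S = (\<Sum>s\<in>S. c s)"


text \<open>A graph on a finite vertex type is given by its set of edges.\<close>

definition bicay :: "'a::ab_group_add set \<Rightarrow> 'a set \<Rightarrow> 'a set \<Rightarrow> ('a + 'a) set set" where
  "bicay R L T =
     {{Inl h, Inl g} | h g. g - h \<in> R} \<union>
     {{Inr h, Inr g} | h g. g - h \<in> L} \<union>
     {{Inl h, Inr g} | h g. g - h \<in> T}"

definition adjacency_matrix :: "'v::finite set set \<Rightarrow> complex^'v^'v" where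
  "adjacency_matrix E = (\<chi> u v. if {u, v} \<in> E then 1 else 0)"

definition eigenvalue :: "complex^'v^'v \<Rightarrow> complex \<Rightarrow> bool" where
  "eigenvalue A \<mu> \<longleftrightarrow> (\<exists>x. x \<noteq> 0 \<and> A *v x = \<mu> *s x)"

definition integral_graph :: "'v::finite set set \<Rightarrow> bool" where
  "integral_graph E \<longleftrightarrow> (\<forall>\<mu>. eigenvalue (adjacency_matrix E) \<mu> \<longrightarrow> \<mu> \<in> \<int>)"

primrec matrix_power :: "complex^'v^'v \<Rightarrow> nat \<Rightarrow> complex^'v^'v" where
  "matrix_power A 0 = mat 1"
| "matrix_power A (Suc k) = A ** matrix_power A k"

definition matrix_exp :: "complex^'v^'v \<Rightarrow> complex^'v^'v" where
  "matrix_exp A = (\<Sum>k. (1 / fact k) *\<^sub>R matrix_power A k)"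

definition transfer_matrix :: "'v::finite set set \<Rightarrow> real \<Rightarrow> complex^'v^'v" where
  "transfer_matrix E t = matrix_exp (\<chi> u v. - \<i> * of_real t * adjacency_matrix E $ u $ v)"

definition perfect_state_transfer :: "'v::finite set set \<Rightarrow> 'v \<Rightarrow> 'v \<Rightarrow> real \<Rightarrow> bool" where
  "perfect_state_transfer E u v t \<longleftrightarrow> norm (transfer_matrix E t $ u $ v) = 1"


text \<open>
  The real numbers \<open>\<lambda>\<^sub>1, \<dots>, \<lambda>\<^sub>2\<^sub>n\<close>; index \<open>j\<close> is \<open>2k - 1\<close> or \<open>2k\<close> with \<open>k = (j + 1) div 2\<close>. The real
  parts lose nothing: \<open>c(R)\<close> is real for every character \<open>c\<close> when \<open>R\<close> is inverse-closed.
\<close>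

definition bicay_eigenvalue ::
  "(nat \<Rightarrow> 'a \<Rightarrow> complex) \<Rightarrow> 'a set \<Rightarrow> 'a set \<Rightarrow> 'a set \<Rightarrow> nat \<Rightarrow> real" where
  "bicay_eigenvalue c R L T j =
     (let k = (j + 1) div 2;
          r = Re (char_sum (c k) R);
          l = Re (char_sum (c k) L);
          s = sqrt ((r - l)\<^sup>2 + 4 * (norm (char_sum (c k) T))\<^sup>2)
      in (if even j then r + l + s else r + l - s) / 2)"

lemma bicay_eigenvalue_even:
  "bicay_eigenvalue c R L T (2 * k) =
     (Re (char_sum (c k) R) + Re (char_sum (c k) L) +
      sqrt ((Re (char_sum (c k) R) - Re (char_sum (c k) L))\<^sup>2 +
            4 * (norm (char_sum (c k) T))\<^sup>2)) / 2"
  by (simp add: bicay_eigenvalue_def Let_def)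

lemma bicay_eigenvalue_odd:
  assumes "k \<ge> 1"
  shows "bicay_eigenvalue c R L T (2 * k - 1) =
     (Re (char_sum (c k) R) + Re (char_sum (c k) L) -
      sqrt ((Re (char_sum (c k) R) - Re (char_sum (c k) L))\<^sup>2 +
            4 * (norm (char_sum (c k) T))\<^sup>2)) / 2"
  using assms by (simp add: bicay_eigenvalue_def Let_def)

lemma char_sum_real:
  fixes c :: "'a::{finite,ab_group_add} \<Rightarrow> complex"
  assumes "character c" and "uminus ` S = S"
  shows "complex_of_real (Re (char_sum c S)) = char_sum c S"
proof -
  have c: "c (g + h) = c g * c h" "c g \<noteq> 0" for g h
    using assms(1) by (auto simp: character_def)
  have c0: "c 0 = 1"
    using c(1)[of 0 0] c(2)[of 0] by simp
  have inv: "c (- g) = inverse (c g)" for g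
    using c(1)[of g "- g"] c0 by (simp add: inverse_unique)
  have prod: "(\<Prod>h\<in>UNIV. c h) \<noteq> 0"
    using c(2) by simp
  have norm1: "norm (c g) = 1" for g
  proof -
    have "(\<Prod>h\<in>UNIV. c h) = (\<Prod>h\<in>UNIV. c (g + h))"
      by (rule prod.reindex_bij_betw[symmetric]) (simp add: bij_plus_right)
    also have "\<dots> = c g ^ CARD('a) * (\<Prod>h\<in>UNIV. c h)"
      by (simp add: c(1) prod.distrib)
    finally have "c g ^ CARD('a) = 1"
      using prod by simp
    then have "norm (c g) ^ CARD('a) = 1"
      by (metis norm_one norm_power)
    moreover have "CARD('a) > 0"
      by simp
    ultimately show ?thesis
      by (metis norm_ge_zero one_power2 power_eq_imp_eq_base power_one zero_le_one)
  qed
  have cnj: "cnj (c g) = c (- g)" for g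
    unfolding inv using norm1[of g]
    by (metis complex_cnj_one complex_mod_mult_cnj complex_norm_square inverse_unique of_real_1
        power_one)
  have "cnj (char_sum c S) = (\<Sum>s\<in>S. c (- s))"
    by (simp add: char_sum_def cnj)
  also have "\<dots> = (\<Sum>s\<in>uminus ` S. c s)"
    by (simp add: sum.reindex)
  finally have "cnj (char_sum c S) = char_sum c S"
    using assms(2) by (simp add: char_sum_def)
  then show ?thesis
    by (simp add: Reals_cnj_iff)
qed


text \<open>
  Greatest common divisor of a set of real numbers all of which are nonnegative integers;
  any other elements would be ignored.
\<close>

definition Gcd_real :: "real set \<Rightarrow> nat" where
  "Gcd_real X = Gcd {m::nat. real m \<in> X}"


text \<open>The 2-adic valuation, meaningful for rational arguments.\<close>

definition v2 :: "real \<Rightarrow> ereal" where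
  "v2 x = (if x = 0 then \<infinity> else
     ereal (of_int (THE j::int.
       \<exists>a b::int. odd a \<and> odd b \<and> x = 2 powi j * (of_int a / of_int b))))"

lemma v2_eqI:
  fixes a b j :: int
  assumes ab: "odd a" "odd b"
  shows "v2 (2 powi j * (of_int a / of_int b)) = ereal (of_int j)"
proof -
  have *: "i \<le> k"
    if odd: "odd p" "odd q" "odd r" "odd s"
      and eq: "(2::real) powi i * (of_int p / of_int q) = 2 powi k * (of_int r / of_int s)"
    for i k p q r s :: int
  proof (rule ccontr)
    assume "\<not> i \<le> k"
    define m where "m = nat (i - k)"
    have i: "i = k + int m" and m: "m > 0"
      using \<open>\<not> i \<le> k\<close> by (auto simp: m_def)
    have nz: "real_of_int q \<noteq> 0" "real_of_int s \<noteq> 0" "(2::real) powi k \<noteq> 0"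
      using odd by auto
    have "(2::real) powi i = 2 powi k * 2 ^ m"
      by (simp add: i power_int_add)
    then have "(2::real) ^ m * (of_int p / of_int q) = of_int r / of_int s"
      using eq nz(3) by (metis (no_types, opaque_lifting) mult.assoc mult_left_cancel)
    then have "(2::real) ^ m * of_int p * of_int s = of_int r * of_int q"
      using nz by (simp add: field_simps)
    then have "2 ^ m * p * s = r * q"
      by (metis (no_types, opaque_lifting) of_int_eq_iff of_int_mult of_int_numeral of_int_power)
    then have "even (r * q)"
      using m by (metis dvd_mult2 dvd_power)
    then show False
      using odd by simp
  qed
  have "(THE i::int. \<exists>p q::int. odd p \<and> odd q \<and>
      2 powi j * (real_of_int a / of_int b) = 2 powi i * (of_int p / of_int q)) = j"
  proof (rule the_equality)
    show "\<exists>p q::int. odd p \<and> odd q \<and>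
        2 powi j * (real_of_int a / of_int b) = 2 powi j * (of_int p / of_int q)"
      using ab by blast
  next
    fix i :: int
    assume "\<exists>p q::int. odd p \<and> odd q \<and>
        2 powi j * (real_of_int a / of_int b) = 2 powi i * (of_int p / of_int q)"
    then obtain p q :: int where "odd p" "odd q"
      "2 powi j * (real_of_int a / of_int b) = 2 powi i * (of_int p / of_int q)"
      by blast
    then show "i = j"
      using *[of p q a b i j] *[of a b p q j i] ab by force
  qed
  moreover have "2 powi j * (real_of_int a / of_int b) \<noteq> 0"
    using ab by auto
  ultimately show ?thesis
    unfolding v2_def by simp
qed

end

theory Submission
  imports Defs
begin

text \<open>
  Characters split the adjacency matrix into two-by-two Hermitian blocks with diagonal \<open>\<chi>(R), \<chi>(L)\<close>
  and off-diagonal entry \<open>\<chi>(T)\<close>. An entry of the transfer matrix joining the two parts is therefore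
  an average of \<open>n\<close> complex numbers, one per character, each of modulus at most 1, and perfect state
  transfer means that they all coincide and have modulus 1. Modulus 1 forces \<open>\<chi>(R) = \<chi>(L)\<close> for every
  character, hence \<open>R = L\<close>, together with \<open>\<chi>(T) \<noteq> 0\<close> and \<open>exp (2 i t |\<chi>(T)|) = -1\<close>; coincidence fixes
  the phases \<open>exp (i t (\<lambda>\<^sub>2 - \<lambda>\<^sub>2\<^sub>k))\<close>, which must be \<open>\<plusminus>1\<close> because complex conjugation of characters
  conjugates them and also preserves them. So \<open>t / \<pi>\<close> and all eigenvalues are rational, hence the
  latter are integers, and the rest is arithmetic of the 2-adic valuation.
\<close>

section \<open>Characters of finite abelian groups\<close>

lemma character_zero:
  assumes "character c" shows "c 0 = 1"
  using assms unfolding character_def by (metis add_0 mult_cancel_right1)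

text \<open>Translation by \<open>g\<close> permutes the group, so the nonzero product of all values
  of \<open>c\<close> is unchanged when multiplied by \<open>c g\<close> to the power of the group
  order. Hence \<open>c g\<close> is a root of unity.\<close>

lemma norm_character:
  fixes c :: "'a::{finite,ab_group_add} \<Rightarrow> complex"
  assumes "character c" shows "norm (c g) = 1"
proof -
  have c: "c (g + h) = c g * c h" "c g \<noteq> 0" for g h
    using assms by (auto simp: character_def)
  have "(\<Prod>h\<in>UNIV. c h) = (\<Prod>h\<in>UNIV. c (g + h))"
    by (rule prod.reindex_bij_betw[symmetric]) (simp add: bij_plus_right)
  also have "\<dots> = c g ^ CARD('a) * (\<Prod>h\<in>UNIV. c h)"
    by (simp add: c(1) prod.distrib)
  finally have "c g ^ CARD('a) = 1"
    using c(2) by simp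
  then show ?thesis
    using power_eq_1_iff by fastforce
qed

lemma character_minus:
  fixes c :: "'a::{finite,ab_group_add} \<Rightarrow> complex"
  assumes "character c" shows "c (- g) = cnj (c g)"
proof -
  have "c (- g) * c g = 1"
    using assms character_zero[OF assms] unfolding character_def by (metis add.left_inverse)
  moreover have "cnj (c g) * c g = 1"
    using complex_norm_square[of "c g"] norm_character[OF assms, of g] by (simp add: mult.commute)
  ultimately show ?thesis
    using assms unfolding character_def by (metis mult_right_cancel)
qed

lemma character_add: "character c \<Longrightarrow> c (g + h) = c g * c h"
  by (simp add: character_def)

lemma character_diff:
  fixes c :: "'a::{finite,ab_group_add} \<Rightarrow> complex"
  assumes "character c" shows "c (g - h) = c g * cnj (c h)"
  using character_add[OF assms, of g "- h"] by (simp add: character_minus[OF assms])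

lemma character_cnj: "character c \<Longrightarrow> character (\<lambda>g. cnj (c g))"
  by (simp add: character_def)

lemma sum_nontrivial_character:
  fixes c :: "'a::{finite,ab_group_add} \<Rightarrow> complex"
  assumes "character c" "c h \<noteq> 1" shows "(\<Sum>g\<in>UNIV. c g) = 0"
proof -
  have "(\<Sum>g\<in>UNIV. c g) = (\<Sum>g\<in>UNIV. c (h + g))"
    by (rule sum.reindex_bij_betw[symmetric]) (simp add: bij_plus_right)
  also have "\<dots> = c h * (\<Sum>g\<in>UNIV. c g)"
    by (simp add: character_add[OF assms(1)] sum_distrib_left)
  finally show ?thesis using assms(2) by simp
qed

text \<open>The pointwise product of \<open>c\<close> with the conjugate of \<open>c'\<close> is
  again a character, and it is trivial exactly when \<open>c = c'\<close>.\<close>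

lemma character_row_orthogonality:
  fixes c c' :: "'a::{finite,ab_group_add} \<Rightarrow> complex"
  assumes "character c" "character c'"
  shows "(\<Sum>g\<in>UNIV. c g * cnj (c' g)) = (if c = c' then of_nat CARD('a) else 0)"
proof -
  have *: "c g * cnj (c' g) = 1 \<longleftrightarrow> c g = c' g" for g
  proof -
    have 1: "c' g * cnj (c' g) = 1"
      using complex_norm_square[of "c' g"] norm_character[OF assms(2), of g] by simp
    then have "cnj (c' g) \<noteq> 0" by auto
    then show ?thesis using 1 by (metis mult_right_cancel)
  qed
  show ?thesis
  proof (cases "c = c'")
    case True
    then show ?thesis using * by simp
  next
    case False
    then obtain h where "c h \<noteq> c' h" by auto
    moreover have "character (\<lambda>g. c g * cnj (c' g))"
      using assms by (simp add: character_def)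
    ultimately show ?thesis
      using sum_nontrivial_character[of "\<lambda>g. c g * cnj (c' g)" h] * False by simp
  qed
qed

section \<open>Column orthogonality and Fourier inversion\<close>

locale all_characters =
  fixes chi :: "nat \<Rightarrow> 'a::{finite,ab_group_add} \<Rightarrow> complex"
  assumes bij_chi: "bij_betw chi {1..CARD('a)} {c. character c}"
begin

lemma character_chi: "k \<in> {1..CARD('a)} \<Longrightarrow> character (chi k)"
  using bij_chi by (auto simp: bij_betw_def)

lemma character_cases:
  assumes "character c" obtains k where "k \<in> {1..CARD('a)}" "c = chi k"
proof -
  have "c \<in> chi ` {1..CARD('a)}"
    using assms bij_chi by (simp add: bij_betw_def)
  then show ?thesis using that by blast
qed

text \<open>The character table is square, so its rows being orthogonal makes its columns orthogonal.\<close>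

lemma column_orthogonality:
  "(\<Sum>k\<in>{1..CARD('a)}. cnj (chi k g) * chi k h) = (if g = h then of_nat CARD('a) else 0)"
proof -
  \<comment> \<open>Matrix indices range over types, so \<open>e\<close> labels the characters by
    group elements; the character table becomes a square matrix over \<open>'a\<close>.\<close>
  obtain e :: "'a \<Rightarrow> nat" where e: "bij_betw e UNIV {1..CARD('a)}"
    using finite_same_card_bij[of "UNIV :: 'a set" "{1..CARD('a)}"] by auto
  define X where "X = (\<chi> i g. chi (e i) g)"
  define Y where "Y = (\<chi> g i. cnj (chi (e i) g) / of_nat CARD('a))"
  have eq: "chi (e i) = chi (e j) \<longleftrightarrow> i = j" for i j
    using e bij_chi by (metis UNIV_I bij_betwE bij_betw_inv_into_left)
  have ch: "character (chi (e i))" for i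
    using character_chi e by (metis UNIV_I bij_betwE)
  have "X ** Y = mat 1"
    unfolding vec_eq_iff
  proof (intro allI)
    fix i j
    have "(X ** Y) $ i $ j = (\<Sum>g\<in>UNIV. chi (e i) g * cnj (chi (e j) g)) / of_nat CARD('a)"
      by (simp add: X_def Y_def matrix_matrix_mult_def sum_divide_distrib)
    also have "\<dots> = mat 1 $ i $ j"
      by (simp add: character_row_orthogonality[OF ch ch] eq mat_def)
    finally show "(X ** Y) $ i $ j = mat 1 $ i $ j" .
  qed
  then have "Y ** X = mat 1"
    by (simp add: matrix_left_right_inverse)
  then have "(Y ** X) $ g $ h = mat 1 $ g $ h" by simp
  then have "(\<Sum>i\<in>UNIV. cnj (chi (e i) g) * chi (e i) h) / of_nat CARD('a)
      = (if g = h then 1 else 0)"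
    by (simp add: X_def Y_def matrix_matrix_mult_def sum_divide_distrib mat_def)
  then have "(\<Sum>i\<in>UNIV. cnj (chi (e i) g) * chi (e i) h) = (if g = h then of_nat CARD('a) else 0)"
    by (auto simp: divide_simps split: if_splits)
  then show ?thesis
    using sum.reindex_bij_betw[OF e, of "\<lambda>k. cnj (chi k g) * chi k h"] by simp
qed

lemma fourier_inversion:
  "(\<Sum>k\<in>{1..CARD('a)}. (\<Sum>h\<in>UNIV. cnj (chi k h) * x h) * chi k g) = of_nat CARD('a) * x g"
proof -
  have "(\<Sum>k\<in>{1..CARD('a)}. (\<Sum>h\<in>UNIV. cnj (chi k h) * x h) * chi k g)
      = (\<Sum>h\<in>UNIV. x h * (\<Sum>k\<in>{1..CARD('a)}. cnj (chi k h) * chi k g))"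
    unfolding sum_distrib_left sum_distrib_right
    by (subst sum.swap) (simp add: mult_ac)
  also have "\<dots> = of_nat CARD('a) * x g"
    unfolding column_orthogonality by (simp add: if_distrib[of "\<lambda>y. _ * y"] cong: if_cong)
  finally show ?thesis .
qed

text \<open>Up to conjugation, character sums are the Fourier coefficients of the indicator
  function, so inversion recovers the set. This is how equality of all \<chi>(R) and \<chi>(L)
  yields \<open>R = L\<close>.\<close>

lemma char_sum_determines_set:
  assumes "\<And>k. k \<in> {1..CARD('a)} \<Longrightarrow> char_sum (chi k) S = char_sum (chi k) S'"
  shows "S = S'"
proof -
  have coeff: "(\<Sum>h\<in>UNIV. cnj (chi k h) * (if h \<in> U then 1 else 0)) = cnj (char_sum (chi k) U)"
    for k and U :: "'a set"
    by (simp add: char_sum_def if_distrib[of "\<lambda>y. _ * y"] sum.If_cases cong: if_cong)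
  have "(if g \<in> S then 1 else 0 :: complex) = (if g \<in> S' then 1 else 0)" for g
  proof -
    have "of_nat CARD('a) * (if g \<in> S then 1 else 0 :: complex)
        = (\<Sum>k\<in>{1..CARD('a)}. cnj (char_sum (chi k) S) * chi k g)"
      using fourier_inversion[of "\<lambda>h. if h \<in> S then 1 else 0" g] by (simp only: coeff)
    also have "\<dots> = (\<Sum>k\<in>{1..CARD('a)}. cnj (char_sum (chi k) S') * chi k g)"
      by (intro sum.cong) (simp_all only: assms)
    also have "\<dots> = of_nat CARD('a) * (if g \<in> S' then 1 else 0)"
      using fourier_inversion[of "\<lambda>h. if h \<in> S' then 1 else 0" g] by (simp only: coeff)
    finally show ?thesis by simp
  qed
  then show ?thesis
    by (metis (full_types) subsetI subset_antisym zero_neq_one)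
qed

end

section \<open>Averages over the unit disc\<close>

lemma norm_le_1_Re_eq_1:
  assumes "norm z \<le> 1" "Re z = 1" shows "z = 1"
proof -
  have "(Re z)\<^sup>2 + (Im z)\<^sup>2 \<le> 1"
    using assms(1) cmod_power2[of z] power_le_one[of "norm z" 2] by simp
  then show ?thesis using assms(2) by (simp add: complex_eq_iff)
qed

text \<open>Equality case of the triangle inequality. Rotating by the conjugate direction of the sum
  makes the sum equal to its maximal value; then real parts bounded by 1 have mean 1, so each
  rotated term is 1.\<close>

lemma norm_sum_eq_card_iff:
  fixes z :: "'i \<Rightarrow> complex"
  assumes fin: "finite I" and j: "j \<in> I" and le: "\<And>i. i \<in> I \<Longrightarrow> norm (z i) \<le> 1"
  shows "norm (\<Sum>i\<in>I. z i) = real (card I) \<longleftrightarrow> norm (z j) = 1 \<and> (\<forall>i\<in>I. z i = z j)"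
proof
  assume eq: "norm (\<Sum>i\<in>I. z i) = real (card I)"
  define S where "S = (\<Sum>i\<in>I. z i)"
  have N: "real (card I) > 0" using fin j by (simp add: card_gt_0_iff) blast
  define w where "w = cnj S / of_nat (card I)"
  have nw: "norm w = 1" using eq N by (simp add: w_def S_def[symmetric] norm_divide)
  have "w * S = of_nat (card I)"
    using complex_norm_square[of S] eq N
    by (simp add: w_def S_def[symmetric] mult.commute power2_eq_square nonzero_divide_eq_eq)
  then have "(\<Sum>i\<in>I. Re (w * z i)) = real (card I)"
    by (metis S_def Re_sum sum_distrib_left complex_Re_of_nat)
  then have "(\<Sum>i\<in>I. 1 - Re (w * z i)) = 0"
    by (simp add: sum_subtractf)
  moreover have le': "norm (w * z i) \<le> 1" if "i \<in> I" for i
    using le[OF that] nw by (simp add: norm_mult)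
  then have "0 \<le> 1 - Re (w * z i)" if "i \<in> I" for i
    using complex_Re_le_cmod[of "w * z i"] that by fastforce
  ultimately have "\<forall>i\<in>I. 1 - Re (w * z i) = 0"
    using sum_nonneg_eq_0_iff[OF fin, of "\<lambda>i. 1 - Re (w * z i)"] by blast
  then have 1: "w * z i = 1" if "i \<in> I" for i
    using norm_le_1_Re_eq_1[OF le'] that by simp
  then have "z i = z j" if "i \<in> I" for i
    using that j by (metis mult_cancel_left mult_zero_left zero_neq_one)
  moreover have "norm (z j) = 1"
    using 1[OF j] nw by (metis mult_cancel_right1 norm_mult norm_one)
  ultimately show "norm (z j) = 1 \<and> (\<forall>i\<in>I. z i = z j)" by blast
next
  assume "norm (z j) = 1 \<and> (\<forall>i\<in>I. z i = z j)"
  then have "(\<Sum>i\<in>I. z i) = of_nat (card I) * z j" "norm (z j) = 1" by auto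
  then show "norm (\<Sum>i\<in>I. z i) = real (card I)" by (simp add: norm_mult)
qed

section \<open>The matrix exponential\<close>

text \<open>The sum of the moduli of all entries dominates every row sum, which is enough to compare
  the exponential series with that of a real number.\<close>

lemma norm_matrix_power_le:
  fixes A :: "complex^'v^'v"
  shows "norm (matrix_power A k $ i $ j) \<le> (\<Sum>i\<in>UNIV. \<Sum>j\<in>UNIV. norm (A $ i $ j)) ^ k"
proof (induction k arbitrary: i j)
  case 0
  then show ?case by (simp add: mat_def)
next
  case (Suc k)
  let ?K = "\<Sum>i\<in>UNIV. \<Sum>j\<in>UNIV. norm (A $ i $ j)"
  have K: "?K ^ k \<ge> 0" by (simp add: sum_nonneg)
  have "norm (matrix_power A (Suc k) $ i $ j)
      \<le> (\<Sum>l\<in>UNIV. norm (A $ i $ l * matrix_power A k $ l $ j))"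
    by (simp add: matrix_matrix_mult_def norm_sum)
  also have "\<dots> \<le> (\<Sum>l\<in>UNIV. norm (A $ i $ l) * ?K ^ k)"
    by (intro sum_mono) (simp add: norm_mult mult_left_mono Suc.IH)
  also have "\<dots> = (\<Sum>l\<in>UNIV. norm (A $ i $ l)) * ?K ^ k"
    by (simp add: sum_distrib_right)
  also have "\<dots> \<le> ?K * ?K ^ k"
    using member_le_sum[of i UNIV "\<lambda>i. \<Sum>l\<in>UNIV. norm (A $ i $ l)"]
    by (intro mult_right_mono[OF _ K]) (simp add: sum_nonneg)
  finally show ?case by simp
qed

text \<open>\<open>matrix_exp\<close> is given by an infinite sum, whose value is meaningful only
  once convergence is known; it follows entry by entry from the bound on powers.\<close>

lemma matrix_exp_sums:
  fixes A :: "complex^'v^'v"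
  shows "(\<lambda>k. (1 / fact k) *\<^sub>R matrix_power A k) sums matrix_exp A"
proof -
  let ?f = "\<lambda>k. (1 / fact k) *\<^sub>R matrix_power A k"
  let ?K = "\<Sum>i\<in>UNIV. \<Sum>j\<in>UNIV. norm (A $ i $ j)"
  have s: "summable (\<lambda>k. ?f k $ i $ j)" for i j
  proof (rule summable_comparison_test')
    show "summable (\<lambda>k. ?K ^ k /\<^sub>R fact k)" by (rule summable_exp_generic)
    show "norm (?f k $ i $ j) \<le> ?K ^ k /\<^sub>R fact k" for k
      using norm_matrix_power_le[of A k i j] by (simp add: divide_simps)
  qed
  have "(\<lambda>n. sum ?f {..<n}) \<longlonglongrightarrow> (\<chi> i j. \<Sum>k. ?f k $ i $ j)"
  proof (intro vec_tendstoI)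
    fix i j
    show "(\<lambda>n. sum ?f {..<n} $ i $ j) \<longlonglongrightarrow> (\<chi> i j. \<Sum>k. ?f k $ i $ j) $ i $ j"
      using summable_LIMSEQ[OF s[of i j]] by simp
  qed
  then have "summable ?f" by (auto simp: summable_def sums_def)
  then show ?thesis unfolding matrix_exp_def by (rule summable_sums)
qed

lemma matrix_exp_entry_sums:
  fixes A :: "complex^'v^'v"
  shows "(\<lambda>k. matrix_power A k $ i $ j /\<^sub>R fact k) sums (matrix_exp A $ i $ j)"
proof -
  have "(\<lambda>k. ((1 / fact k) *\<^sub>R matrix_power A k) $ i $ j) sums (matrix_exp A $ i $ j)"
    by (rule bounded_linear.sums[OF bounded_linear_compose
          [OF bounded_linear_vec_nth bounded_linear_vec_nth] matrix_exp_sums])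
  then show ?thesis by (simp add: divide_inverse)
qed

text \<open>Powers of \<open>A\<close> act on \<open>x\<close> as powers of \<mu>, and the series is
  summed coordinatewise. Transfer matrices can thus be evaluated on eigenvectors without
  diagonalising a matrix.\<close>

lemma matrix_exp_eigenvector:
  fixes A :: "complex^'v^'v"
  assumes "A *v x = \<mu> *s x"
  shows "matrix_exp A *v x = exp \<mu> *s x"
proof -
  have pow: "matrix_power A k *v x = \<mu> ^ k *s x" for k
    by (induction k)
      (simp_all add: matrix_vector_mul_assoc[symmetric] vector_scalar_commute assms mult.commute)
  have "(matrix_exp A *v x) $ i = (exp \<mu> *s x) $ i" for i
  proof (rule sums_unique2)
    have "(\<lambda>k. \<Sum>j\<in>UNIV. matrix_power A k $ i $ j /\<^sub>R fact k * x $ j)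
        sums (\<Sum>j\<in>UNIV. matrix_exp A $ i $ j * x $ j)"
      by (intro sums_sum sums_mult2 matrix_exp_entry_sums)
    moreover have "(\<Sum>j\<in>UNIV. matrix_power A k $ i $ j /\<^sub>R fact k * x $ j)
        = \<mu> ^ k /\<^sub>R fact k * x $ i" for k
    proof -
      have "(\<Sum>j\<in>UNIV. matrix_power A k $ i $ j /\<^sub>R fact k * x $ j)
          = (matrix_power A k *v x) $ i /\<^sub>R fact k"
        by (simp add: matrix_vector_mult_def scaleR_sum_right)
      then show ?thesis by (simp add: pow)
    qed
    ultimately show "(\<lambda>k. \<mu> ^ k /\<^sub>R fact k * x $ i) sums (matrix_exp A *v x) $ i"
      by (simp add: matrix_vector_mult_def)
    show "(\<lambda>k. \<mu> ^ k /\<^sub>R fact k * x $ i) sums (exp \<mu> *s x) $ i"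
      using sums_mult2[OF exp_converges[of \<mu>], of "x $ i"] by simp
  qed
  then show ?thesis by (simp add: vec_eq_iff)
qed

lemma matrix_power_commute: "matrix_power A k ** A = A ** matrix_power A k"
  by (induction k) (simp_all add: matrix_mul_assoc[symmetric])

lemma transpose_matrix_power:
  assumes "transpose A = A" shows "transpose (matrix_power A k) = matrix_power A k"
  by (induction k) (simp_all add: matrix_transpose_mul assms matrix_power_commute)

lemma matrix_exp_symmetric:
  fixes A :: "complex^'v^'v"
  assumes "transpose A = A" shows "matrix_exp A $ i $ j = matrix_exp A $ j $ i"
proof (rule sums_unique2[OF matrix_exp_entry_sums])
  have "matrix_power A k $ i $ j = matrix_power A k $ j $ i" for k
    using arg_cong[OF transpose_matrix_power[OF assms, of k], of "\<lambda>B. B $ i $ j"]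
    by (simp add: transpose_def)
  then show "(\<lambda>k. matrix_power A k $ i $ j /\<^sub>R fact k) sums (matrix_exp A $ j $ i)"
    using matrix_exp_entry_sums[of A j i] by simp
qed

text \<open>Reduces a pair starting in part 1 to one starting in part 0. Edges are unordered, so the
  adjacency matrix is symmetric, and so are its powers.\<close>

lemma transfer_matrix_symmetric: "transfer_matrix E t $ u $ v = transfer_matrix E t $ v $ u"
  unfolding transfer_matrix_def
  by (rule matrix_exp_symmetric) (simp add: transpose_def adjacency_matrix_def insert_commute)

lemma transfer_matrix_eigenvector:
  assumes "adjacency_matrix E *v x = \<mu> *s x"
  shows "transfer_matrix E t *v x = exp (- \<i> * of_real t * \<mu>) *s x"
  unfolding transfer_matrix_def
proof (rule matrix_exp_eigenvector)
  have "(\<chi> u v. - \<i> * of_real t * adjacency_matrix E $ u $ v) *v x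
      = (- \<i> * of_real t) *s (adjacency_matrix E *v x)"
    by (simp add: vec_eq_iff matrix_vector_mult_def sum_distrib_left mult.assoc sum_negf)
  then show "(\<chi> u v. - \<i> * of_real t * adjacency_matrix E $ u $ v) *v x
      = (- \<i> * of_real t * \<mu>) *s x"
    by (simp add: assms)
qed

section \<open>Spectral decomposition of bi-Cayley graphs\<close>

text \<open>Edges are unordered, so inside a part both differences \<open>g - h\<close> and
  \<open>h - g\<close> occur, and closure under inverses identifies them. Across the parts the tags
  \<open>Inl\<close> and \<open>Inr\<close> fix the orientation.\<close>

lemma bicay_edges:
  fixes R L T :: "'a::ab_group_add set"
  assumes "uminus ` R = R" "uminus ` L = L"
  shows "{Inl h, Inl g} \<in> bicay R L T \<longleftrightarrow> g - h \<in> R"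
    and "{Inr h, Inr g} \<in> bicay R L T \<longleftrightarrow> g - h \<in> L"
    and "{Inl h, Inr g} \<in> bicay R L T \<longleftrightarrow> g - h \<in> T"
    and "{Inr g, Inl h} \<in> bicay R L T \<longleftrightarrow> g - h \<in> T"
proof -
  have "h - g \<in> R \<longleftrightarrow> g - h \<in> R" "h - g \<in> L \<longleftrightarrow> g - h \<in> L" for g h
    using assms by (metis image_eqI minus_diff_eq)+
  then show "{Inl h, Inl g} \<in> bicay R L T \<longleftrightarrow> g - h \<in> R"
    and "{Inr h, Inr g} \<in> bicay R L T \<longleftrightarrow> g - h \<in> L"
    and "{Inl h, Inr g} \<in> bicay R L T \<longleftrightarrow> g - h \<in> T"
    and "{Inr g, Inl h} \<in> bicay R L T \<longleftrightarrow> g - h \<in> T"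
    by (auto simp: bicay_def doubleton_eq_iff)
qed

lemma sum_indicator_translate:
  fixes f :: "'a::{finite,ab_group_add} \<Rightarrow> complex"
  shows "(\<Sum>g\<in>UNIV. (if g - h \<in> S then 1 else 0) * f g) = (\<Sum>s\<in>S. f (h + s))"
    and "(\<Sum>g\<in>UNIV. (if h - g \<in> S then 1 else 0) * f g) = (\<Sum>s\<in>S. f (h - s))"
proof -
  have *: "(\<Sum>g\<in>UNIV. (if P g then 1 else 0) * f g) = (\<Sum>g | P g. f g)" for P
    by (simp add: if_distrib[of "\<lambda>y. y * _"] sum.If_cases cong: if_cong)
  show "(\<Sum>g\<in>UNIV. (if g - h \<in> S then 1 else 0) * f g) = (\<Sum>s\<in>S. f (h + s))"
    unfolding * by (rule sum.reindex_bij_witness[of _ "\<lambda>s. h + s" "\<lambda>g. g - h"]) auto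
  show "(\<Sum>g\<in>UNIV. (if h - g \<in> S then 1 else 0) * f g) = (\<Sum>s\<in>S. f (h - s))"
    unfolding * by (rule sum.reindex_bij_witness[of _ "\<lambda>s. h - s" "\<lambda>g. h - g"]) auto
qed

lemma sum_UNIV_sum_type:
  fixes f :: "'a::finite + 'b::finite \<Rightarrow> 'c::comm_monoid_add"
  shows "(\<Sum>u\<in>UNIV. f u) = (\<Sum>g\<in>UNIV. f (Inl g)) + (\<Sum>g\<in>UNIV. f (Inr g))"
  unfolding UNIV_Plus_UNIV[symmetric] by (subst sum.Plus) simp_all

lemma adjacency_bicay_mult:
  fixes R L T :: "'a::{finite,ab_group_add} set"
  assumes "uminus ` R = R" "uminus ` L = L"
  shows "(adjacency_matrix (bicay R L T) *v x) $ Inl h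
      = (\<Sum>s\<in>R. x $ Inl (h + s)) + (\<Sum>s\<in>T. x $ Inr (h + s))"
    and "(adjacency_matrix (bicay R L T) *v x) $ Inr g
      = (\<Sum>s\<in>T. x $ Inl (g - s)) + (\<Sum>s\<in>L. x $ Inr (g + s))"
  by (simp_all add: matrix_vector_mult_def adjacency_matrix_def sum_UNIV_sum_type
      bicay_edges[OF assms] sum_indicator_translate del: mult_if_delta if_distribR)

text \<open>For a fixed character these vectors form the invariant subspace carrying its two-by-two
  block; \<open>(a, b)\<close> are the coordinates there.\<close>

definition bicay_vec :: "complex \<Rightarrow> complex \<Rightarrow> ('a::finite \<Rightarrow> complex) \<Rightarrow> complex^('a + 'a)" where
  "bicay_vec a b c = (\<chi> u. case u of Inl g \<Rightarrow> a * c g | Inr g \<Rightarrow> b * c g)"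

lemma bicay_vec_nth [simp]:
  "bicay_vec a b c $ Inl g = a * c g" "bicay_vec a b c $ Inr g = b * c g"
  by (simp_all add: bicay_vec_def)

lemma vec_sum_type_eq_iff: "x = y \<longleftrightarrow> (\<forall>g. x $ Inl g = y $ Inl g) \<and> (\<forall>g. x $ Inr g = y $ Inr g)"
  for x y :: "'c^('a::finite + 'b::finite)"
  unfolding vec_eq_iff by (metis sum.exhaust)

text \<open>The two equations say that \<open>(a, b)\<close> satisfies the eigenvector equation of
  the block. The conjugate of \<chi>(T) appears because a vertex of part 1 reaches part 0 by
  subtracting elements of \<open>T\<close>.\<close>

lemma adjacency_bicay_eigenvector:
  fixes R L T :: "'a::{finite,ab_group_add} set"
  assumes "uminus ` R = R" "uminus ` L = L" and c: "character c"
    and 1: "char_sum c R * a + char_sum c T * b = \<mu> * a"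
    and 2: "cnj (char_sum c T) * a + char_sum c L * b = \<mu> * b"
  shows "adjacency_matrix (bicay R L T) *v bicay_vec a b c = \<mu> *s bicay_vec a b c"
proof -
  have S: "(\<Sum>s\<in>S. z * c (h + s)) = char_sum c S * z * c h"
    "(\<Sum>s\<in>S. z * c (h - s)) = cnj (char_sum c S) * z * c h" for z h and S :: "'a set"
    by (simp_all add: char_sum_def character_add[OF c] character_diff[OF c] sum_distrib_left
        sum_distrib_right mult_ac)
  have "char_sum c R * a * c h + char_sum c T * b * c h = \<mu> * (a * c h)"
    "cnj (char_sum c T) * a * c h + char_sum c L * b * c h = \<mu> * (b * c h)" for h
    using arg_cong[OF 1, of "\<lambda>z. z * c h"] arg_cong[OF 2, of "\<lambda>z. z * c h"]
    by (simp_all add: algebra_simps)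
  then show ?thesis
    by (simp add: vec_sum_type_eq_iff adjacency_bicay_mult[OF assms(1,2)] S)
qed

text \<open>The eigenvalues of the two-by-two block attached to a character are \<open>(r + l \<plusminus> gap) / 2\<close>.\<close>

definition bicay_gap :: "('a \<Rightarrow> complex) \<Rightarrow> 'a set \<Rightarrow> 'a set \<Rightarrow> 'a set \<Rightarrow> real" where
  "bicay_gap c R L T = sqrt ((Re (char_sum c R) - Re (char_sum c L))\<^sup>2 +
     4 * (norm (char_sum c T))\<^sup>2)"

text \<open>The vector with coordinates \<chi>(T) and \<mu> - \<chi>(R) satisfies the first row
  identically; the second row is then the characteristic equation, whose discriminant is the square
  of \<open>s\<close>.\<close>

lemma adjacency_bicay_root_eigenvector:
  fixes R L T :: "'a::{finite,ab_group_add} set"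
  assumes "uminus ` R = R" "uminus ` L = L" and c: "character c"
    and s: "s = bicay_gap c R L T \<or> s = - bicay_gap c R L T"
    and \<mu>: "\<mu> = complex_of_real ((Re (char_sum c R) + Re (char_sum c L) + s) / 2)"
  shows "adjacency_matrix (bicay R L T) *v bicay_vec (char_sum c T) (\<mu> - char_sum c R) c
    = \<mu> *s bicay_vec (char_sum c T) (\<mu> - char_sum c R) c"
proof (rule adjacency_bicay_eigenvector[OF assms(1-3)])
  define r l where rl: "r = Re (char_sum c R)" "l = Re (char_sum c L)"
  let ?t = "norm (char_sum c T)" and ?m = "(r + l + s) / 2"
  have R: "char_sum c R = of_real r" and L: "char_sum c L = of_real l"
    using char_sum_real[OF c] assms(1,2) by (simp_all add: rl)
  have "s\<^sup>2 = (r - l)\<^sup>2 + 4 * ?t\<^sup>2"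
    using s by (auto simp: bicay_gap_def rl)
  then have "?t\<^sup>2 + l * (?m - r) = ?m * (?m - r)"
    by (simp add: power2_eq_square field_simps)
  then have "complex_of_real (?t\<^sup>2 + l * (?m - r)) = complex_of_real (?m * (?m - r))"
    by (rule arg_cong)
  then have "complex_of_real (?t\<^sup>2) + char_sum c L * (\<mu> - char_sum c R) = \<mu> * (\<mu> - char_sum c R)"
    unfolding \<mu> rl[symmetric] unfolding R L by (simp only: of_real_add of_real_mult of_real_diff)
  then show "cnj (char_sum c T) * char_sum c T + char_sum c L * (\<mu> - char_sum c R)
      = \<mu> * (\<mu> - char_sum c R)"
    by (simp only: complex_norm_square mult.commute)
qed (simp add: algebra_simps)

text \<open>The off-diagonal entry of the exponential of the block: \<chi>(T) times the divided
  difference of the exponential at the two block eigenvalues. If the gap is 0 then \<chi>(T) = 0,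
  and the convention for division by zero gives the correct value 0. The form \<open>+ -\<close>
  matches the root \<open>s = - bicay_gap c R L T\<close>.\<close>

definition transfer_coeff ::
  "('a \<Rightarrow> complex) \<Rightarrow> 'a set \<Rightarrow> 'a set \<Rightarrow> 'a set \<Rightarrow> real \<Rightarrow> complex" where
  "transfer_coeff c R L T t = char_sum c T / bicay_gap c R L T *
     (exp (- \<i> * of_real t *
        of_real ((Re (char_sum c R) + Re (char_sum c L) + bicay_gap c R L T) / 2)) -
      exp (- \<i> * of_real t *
        of_real ((Re (char_sum c R) + Re (char_sum c L) + - bicay_gap c R L T) / 2)))"

lemma transfer_bicay_character:
  fixes R L T :: "'a::{finite,ab_group_add} set"
  assumes RL: "uminus ` R = R" "uminus ` L = L" and c: "character c"
  shows "(transfer_matrix (bicay R L T) t *v bicay_vec 0 1 c) $ Inl g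
    = transfer_coeff c R L T t * c g"
proof (cases "char_sum c T = 0")
  case True
  \<comment> \<open>Here the block is diagonal, so the second coordinate vector is already an
    eigenvector.\<close>
  have "adjacency_matrix (bicay R L T) *v bicay_vec 0 1 c = char_sum c L *s bicay_vec 0 1 c"
    by (rule adjacency_bicay_eigenvector[OF assms]) (simp_all add: True)
  from transfer_matrix_eigenvector[OF this, of t] show ?thesis
    by (simp add: transfer_coeff_def True)
next
  case False
  let ?s = "bicay_gap c R L T"
  let ?m = "\<lambda>s. complex_of_real ((Re (char_sum c R) + Re (char_sum c L) + s) / 2)"
  let ?v = "\<lambda>s. bicay_vec (char_sum c T) (?m s - char_sum c R) c"
  let ?H = "transfer_matrix (bicay R L T) t"
  have s: "?s > 0"
    using False by (simp add: bicay_gap_def add_nonneg_pos)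
  have H: "?H *v ?v s = exp (- \<i> * of_real t * ?m s) *s ?v s" if "s = ?s \<or> s = - ?s" for s
    by (rule transfer_matrix_eigenvector[OF adjacency_bicay_root_eigenvector[OF assms that refl]])
  \<comment> \<open>The two eigenvectors share their first coordinate, and their second coordinates
    differ by the gap.\<close>
  have "of_real ?s *s bicay_vec 0 1 c = ?v ?s - ?v (- ?s)"
    by (simp add: vec_sum_type_eq_iff) (simp add: field_simps)
  then have "of_real ?s *s (?H *v bicay_vec 0 1 c) = ?H *v ?v ?s - ?H *v ?v (- ?s)"
    by (metis matrix_vector_mult_diff_distrib vector_scalar_commute)
  then have "of_real ?s * (?H *v bicay_vec 0 1 c) $ Inl g
      = (?H *v ?v ?s - ?H *v ?v (- ?s)) $ Inl g"
    by (metis vector_smult_component)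
  also have "\<dots> = (exp (- \<i> * of_real t * ?m ?s) - exp (- \<i> * of_real t * ?m (- ?s)))
      * (char_sum c T * c g)"
    unfolding H[OF disjI1[OF refl]] H[OF disjI2[OF refl]]
    by (simp only: vector_minus_component vector_smult_component bicay_vec_nth left_diff_distrib)
  finally show ?thesis
    using s unfolding transfer_coeff_def by (simp add: divide_simps mult_ac)
qed

lemma matrix_vector_mult_sum:
  fixes A :: "complex^'m^'k"
  shows "A *v (\<Sum>i\<in>S. f i) = (\<Sum>i\<in>S. A *v f i)"
  by (induction S rule: infinite_finite_induct) (simp_all add: matrix_vector_right_distrib)

text \<open>Column orthogonality expands a multiple of the unit vector at \<open>Inr q\<close> in
  the vectors \<open>bicay_vec 0 1 (chi k)\<close>, on whose part 0 the transfer matrix acts by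
  \<open>transfer_coeff\<close>.\<close>

lemma (in all_characters) transfer_bicay_entry:
  assumes RL: "uminus ` R = R" "uminus ` L = L"
  shows "of_nat CARD('a) * transfer_matrix (bicay R L T) t $ Inl p $ Inr q
    = (\<Sum>k\<in>{1..CARD('a)}. chi k (p - q) * transfer_coeff (chi k) R L T t)"
proof -
  let ?H = "transfer_matrix (bicay R L T) t"
  have "of_nat CARD('a) *s axis (Inr q) 1
      = (\<Sum>k\<in>{1..CARD('a)}. cnj (chi k q) *s bicay_vec 0 1 (chi k))"
    unfolding vec_sum_type_eq_iff
    by (simp add: axis_def del: One_nat_def)
      (auto simp: column_orthogonality[unfolded One_nat_def])
  then have "?H *v (of_nat CARD('a) *s axis (Inr q) 1)
      = (\<Sum>k\<in>{1..CARD('a)}. cnj (chi k q) *s (?H *v bicay_vec 0 1 (chi k)))"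
    by (simp add: matrix_vector_mult_sum vector_scalar_commute)
  then have "(?H *v (of_nat CARD('a) *s axis (Inr q) 1)) $ Inl p
      = (\<Sum>k\<in>{1..CARD('a)}. cnj (chi k q) * (?H *v bicay_vec 0 1 (chi k)) $ Inl p)"
    by simp
  also have "\<dots> = (\<Sum>k\<in>{1..CARD('a)}. chi k (p - q) * transfer_coeff (chi k) R L T t)"
    by (intro sum.cong refl)
      (simp only: transfer_bicay_character[OF RL character_chi] character_diff[OF character_chi] mult_ac)
  finally show ?thesis
    by (simp add: vector_scalar_commute) (simp add: matrix_vector_mult_def axis_def
        if_distrib[of "\<lambda>y. _ * y"] cong: if_cong)
qed

section \<open>Modulus and phase of the transfer coefficients\<close>

lemma norm_1_minus_eq_2:
  fixes z :: complex
  assumes "norm z = 1" "norm (1 - z) = 2" shows "z = - 1"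
proof -
  have "(norm (1 - z))\<^sup>2 = 1 + (norm z)\<^sup>2 - 2 * Re z"
    unfolding cmod_power2 by (simp add: power2_eq_square algebra_simps)
  then have "Re (- z) = 1" using assms by simp
  then have "- z = 1" using assms by (intro norm_le_1_Re_eq_1) simp_all
  then show ?thesis by (metis minus_minus)
qed

text \<open>Up to a common phase the coefficient is \<chi>(T) / \<open>s\<close> times 1 - exp(i t
  \<open>s\<close>), where \<open>s\<close> is the gap. The gap is at least 2|\<chi>(T)|, with
  equality iff \<chi>(R) = \<chi>(L), and the last factor has modulus at most 2, with equality iff
  the exponential is -1.\<close>

lemma transfer_coeff_bounds:
  fixes c :: "'a \<Rightarrow> complex"
  shows norm_transfer_coeff_le: "norm (transfer_coeff c R L T t) \<le> 1"
    and norm_transfer_coeff_eq_1: "norm (transfer_coeff c R L T t) = 1 \<longleftrightarrow>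
      Re (char_sum c R) = Re (char_sum c L) \<and> char_sum c T \<noteq> 0 \<and>
      exp (\<i> * of_real (t * (2 * norm (char_sum c T)))) = - 1" (is "?A \<longleftrightarrow> ?B")
proof -
  define r l \<tau> s where defs: "r = Re (char_sum c R)" "l = Re (char_sum c L)"
    "\<tau> = char_sum c T" "s = bicay_gap c R L T"
  define N where "N = norm (1 - exp (\<i> * of_real (t * s)))"
  have s2: "s\<^sup>2 = (r - l)\<^sup>2 + 4 * (norm \<tau>)\<^sup>2" and s0: "s \<ge> 0"
    by (simp_all add: defs bicay_gap_def)
  have s: "2 * norm \<tau> \<le> s"
    by (rule power2_le_imp_le) (simp_all add: s2 s0 power_mult_distrib)
  have N2: "N \<le> 2"
    unfolding N_def using norm_triangle_ineq4[of 1 "exp (\<i> * of_real (t * s))"] by simp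
  have "exp (- \<i> * of_real t * of_real ((r + l + - s) / 2))
      = exp (- \<i> * of_real t * of_real ((r + l + s) / 2)) * exp (\<i> * of_real (t * s))"
    unfolding exp_add[symmetric] by (rule arg_cong[of _ _ exp]) (simp add: field_simps)
  then have "transfer_coeff c R L T t = \<tau> / of_real s *
      (exp (- \<i> * of_real t * of_real ((r + l + s) / 2)) * (1 - exp (\<i> * of_real (t * s))))"
    unfolding transfer_coeff_def defs[symmetric] by (simp only: right_diff_distrib mult_1_right)
  moreover have "norm (exp (- \<i> * of_real t * of_real ((r + l + s) / 2))) = 1"
    by (simp add: norm_exp_eq_Re)
  ultimately have norm: "norm (transfer_coeff c R L T t) = norm \<tau> / s * N"
    using s0 by (simp only: norm_mult norm_divide N_def) simp
  have "norm \<tau> / s * N \<le> norm \<tau> / s * 2"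
    using s0 N2 by (intro mult_left_mono) simp_all
  also have "\<dots> \<le> 1"
    using s s0 by (cases "s = 0") (simp_all add: divide_simps)
  finally show "norm (transfer_coeff c R L T t) \<le> 1" by (simp add: norm)
  show "?A \<longleftrightarrow> ?B"
  proof
    assume ?A
    then have *: "norm \<tau> / s * N = 1" by (simp only: norm)
    then have "s \<noteq> 0" "\<tau> \<noteq> 0"
      by (metis div_by_0 divide_eq_0_iff mult_zero_left norm_zero zero_neq_one)+
    then have sN: "norm \<tau> * N = s" using * by (simp add: divide_simps)
    \<comment> \<open>The chain \<open>s\<close> = |\<tau>| \<open>N\<close> \<le> 2|\<tau>| \<le>
      \<open>s\<close> forces equality in both estimates.\<close>
    have "norm \<tau> * N \<le> norm \<tau> * 2" using N2 by (intro mult_left_mono) simp_all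
    then have s': "s = 2 * norm \<tau>" using sN s by simp
    then have "N = 2" using sN \<open>\<tau> \<noteq> 0\<close> by simp
    moreover have "r = l" using s2 unfolding s' by (simp add: power_mult_distrib)
    ultimately show ?B
      using norm_1_minus_eq_2[of "exp (\<i> * of_real (t * s))"] \<open>\<tau> \<noteq> 0\<close>
      unfolding N_def s' defs by simp
  next
    assume ?B
    then have "r = l" "\<tau> \<noteq> 0" and e: "exp (\<i> * of_real (t * (2 * norm \<tau>))) = - 1"
      by (simp_all add: defs)
    then have "s\<^sup>2 = (2 * norm \<tau>)\<^sup>2" using s2 by (simp add: power_mult_distrib)
    then have s': "s = 2 * norm \<tau>" using s0
      by (simp only: power2_eq_iff_nonneg norm_ge_zero mult_nonneg_nonneg zero_le_numeral)
    then have "N = 2" unfolding N_def s' e by simp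
    then show ?A using s' \<open>\<tau> \<noteq> 0\<close> by (simp add: norm)
  qed
qed

text \<open>In the extremal case the second exponential is the negative of the first, so their
  difference doubles it and cancels the 2 in the gap 2|\<chi>(T)|.\<close>

lemma transfer_coeff_eq:
  fixes c :: "'a \<Rightarrow> complex"
  assumes "Re (char_sum c R) = Re (char_sum c L)" "char_sum c T \<noteq> 0"
    "exp (\<i> * of_real (t * (2 * norm (char_sum c T)))) = - 1"
  shows "transfer_coeff c R L T t = char_sum c T / norm (char_sum c T) *
    exp (- \<i> * of_real (t * (Re (char_sum c R) + norm (char_sum c T))))"
proof -
  define r \<tau> where defs: "r = Re (char_sum c R)" "\<tau> = char_sum c T"
  have "bicay_gap c R L T = sqrt ((2 * norm \<tau>)\<^sup>2)"
    using assms(1) by (simp add: bicay_gap_def defs power_mult_distrib)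
  then have s: "bicay_gap c R L T = 2 * norm \<tau>" by (simp only: real_sqrt_abs) simp
  have "exp (- \<i> * of_real t * of_real (r - norm \<tau>))
      = exp (- \<i> * of_real (t * (r + norm \<tau>))) * exp (\<i> * of_real (t * (2 * norm \<tau>)))"
    unfolding exp_add[symmetric] by (rule arg_cong[of _ _ exp]) (simp add: field_simps)
  then have "exp (- \<i> * of_real t * of_real (r - norm \<tau>))
      = - exp (- \<i> * of_real (t * (r + norm \<tau>)))"
    using assms(3) by (simp add: defs)
  moreover have "(r + r + 2 * norm \<tau>) / 2 = r + norm \<tau>" "(r + r + - (2 * norm \<tau>)) / 2 = r - norm \<tau>"
    by simp_all
  ultimately have "transfer_coeff c R L T t = \<tau> / of_real (2 * norm \<tau>) *
      (2 * exp (- \<i> * of_real (t * (r + norm \<tau>))))"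
    unfolding transfer_coeff_def s assms(1)[symmetric] defs[symmetric]
    by (simp only: mult.assoc of_real_mult) simp
  then show ?thesis
    unfolding defs by simp
qed

section \<open>Rational eigenvalues and 2-adic valuations\<close>

text \<open>Modulo \<open>q\<close> the matrix is \<open>p\<close> times the identity: in the
  Leibniz expansion a non-identity permutation picks an off-diagonal entry, which is a multiple of
  \<open>q\<close>.\<close>

lemma det_diagonal_mod:
  fixes A :: "int^'v^'v"
  shows "q dvd det (\<chi> i j. (if i = j then p else 0) - q * A $ i $ j) - p ^ CARD('v)"
proof -
  define B :: "int^'v^'v" where "B = (\<chi> i j. (if i = j then p else 0) - q * A $ i $ j)"
  define f where "f \<pi> = of_int (sign \<pi>) * (\<Prod>i\<in>UNIV. B $ i $ \<pi> i)" for \<pi> :: "'v \<Rightarrow> 'v"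
  let ?P = "{\<pi>. \<pi> permutes (UNIV :: 'v set)}"
  have fin: "finite ?P" by (simp add: finite_permutations)
  have "det B = f id + sum f (?P - {id})"
    unfolding det_def f_def[symmetric] by (rule sum.remove[OF fin]) (simp add: permutes_id)
  moreover have "q dvd sum f (?P - {id})"
  proof (rule dvd_sum)
    fix \<pi> assume "\<pi> \<in> ?P - {id}"
    then obtain i where "\<pi> i \<noteq> i" by (auto simp: fun_eq_iff)
    then have "q dvd B $ i $ \<pi> i" by (auto simp: B_def)
    also have "\<dots> dvd (\<Prod>i\<in>UNIV. B $ i $ \<pi> i)" by (rule dvd_prodI) simp_all
    finally show "q dvd f \<pi>" by (simp add: f_def)
  qed
  moreover have "q dvd f id - p ^ CARD('v)"
  proof -
    have "(\<Prod>i\<in>(UNIV :: 'v set). B $ i $ i) mod q = (\<Prod>i\<in>(UNIV :: 'v set). B $ i $ i mod q) mod q"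
      by (simp add: mod_prod_eq)
    also have "\<dots> = (\<Prod>i\<in>(UNIV :: 'v set). p mod q) mod q"
      by (simp add: B_def mod_diff_eq[symmetric])
    finally show ?thesis by (simp add: f_def sign_id power_mod mod_eq_dvd_iff)
  qed
  ultimately have "q dvd (f id - p ^ CARD('v)) + sum f (?P - {id})"
    and "det B - p ^ CARD('v) = (f id - p ^ CARD('v)) + sum f (?P - {id})"
    by simp_all
  then show ?thesis
    unfolding B_def[symmetric] by (simp only:)
qed

text \<open>Write the eigenvalue as \<open>p / q\<close> in lowest terms. Then \<open>det (p I - q A)\<close> vanishes, but modulo
  \<open>q\<close> it is a power of \<open>p\<close>.\<close>

lemma rational_eigenvalue_int:
  fixes A :: "int^'v^'v"
  assumes ev: "eigenvalue (\<chi> i j. of_int (A $ i $ j)) \<mu>" and "\<mu> \<in> \<rat>"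
  shows "\<mu> \<in> \<int>"
proof -
  obtain p q :: int where pq: "q > 0" "coprime p q" "\<mu> = of_int p / of_int q"
    using assms(2) by (rule Rats_cases')
  define B :: "int^'v^'v" where "B = (\<chi> i j. (if i = j then p else 0) - q * A $ i $ j)"
  define B' :: "complex^'v^'v" where "B' = (\<chi> i j. of_int (B $ i $ j))"
  obtain x where x: "x \<noteq> 0" "(\<chi> i j. of_int (A $ i $ j)) *v x = \<mu> *s x"
    using ev by (auto simp: eigenvalue_def)
  have "(B' *v x) $ i = 0" for i
  proof -
    have "(B' *v x) $ i = of_int p * x $ i - of_int q * ((\<chi> i j. of_int (A $ i $ j)) *v x) $ i"
      by (simp add: B'_def B_def matrix_vector_mult_def left_diff_distrib sum_subtractf
          sum_distrib_left mult.assoc if_distrib[of "\<lambda>y. of_int y * _"] cong: if_cong)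
    also have "\<dots> = 0" unfolding x(2) using pq(1,3) by simp
    finally show ?thesis .
  qed
  then have "B' *v x = 0" by (simp add: vec_eq_iff)
  then have "\<not> invertible B'"
    using x(1) unfolding invertible_left_inverse matrix_left_invertible_ker by blast
  then have "det B' = 0" by (simp add: invertible_det_nz)
  moreover have "det B' = of_int (det B)"
    by (simp add: det_def B'_def)
  ultimately have "det B = 0" by simp
  then have "q dvd p ^ CARD('v)"
    using det_diagonal_mod[of q p A] unfolding B_def by simp
  moreover have "coprime q (p ^ CARD('v))"
    using pq(2) by (simp add: coprime_commute)
  ultimately have "is_unit q" by (metis coprime_common_divisor dvd_refl)
  then have "q = 1" using pq(1) by simp
  then show ?thesis by (simp add: pq(3))
qed

lemma integer_eigenvalue_adjacency_matrix:
  assumes "eigenvalue (adjacency_matrix E) \<mu>" "\<mu> \<in> \<rat>" shows "\<mu> \<in> \<int>"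
proof (rule rational_eigenvalue_int)
  have "(\<chi> i j. of_int ((\<chi> i j. if {i, j} \<in> E then 1 else 0) $ i $ j)) = adjacency_matrix E"
    by (simp add: vec_eq_iff adjacency_matrix_def)
  then show "eigenvalue (\<chi> i j. of_int ((\<chi> i j. if {i, j} \<in> E then 1 else 0) $ i $ j)) \<mu>"
    using assms(1) by simp
qed (fact assms(2))

section \<open>Valuations of natural numbers and times at which phases are signs\<close>

lemma v2_nat:
  assumes "n > 0" shows "v2 (real n) = ereal (real (multiplicity 2 n))"
proof -
  obtain m where m: "n = 2 ^ multiplicity 2 n * m" "odd m"
    using multiplicity_decompose'[of n 2] assms by auto
  have "real n = 2 powi int (multiplicity 2 n) * (of_int (int m) / of_int 1)"
    by (subst m(1)) simp
  moreover have "odd (int m)" using m(2) by simp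
  ultimately show ?thesis using v2_eqI[of "int m" 1 "int (multiplicity 2 n)"] by simp
qed

lemma Gcd_real_image: "Gcd_real {real (f k) | k. k \<in> I} = Gcd (f ` I)"
proof -
  have "{m. real m \<in> {real (f k) | k. k \<in> I}} = f ` I" by auto
  then show ?thesis by (simp add: Gcd_real_def)
qed

lemma exp_pi_eq_1_iff: "exp (\<i> * of_real (x * pi)) = 1 \<longleftrightarrow> (\<exists>z::int. x = 2 * of_int z)"
proof -
  have "exp (\<i> * of_real (x * pi)) = 1 \<longleftrightarrow> (\<exists>z::int. x * pi = (2 * of_int z) * pi)"
    by (simp add: exp_eq_1 mult_ac)
  then show ?thesis by simp
qed

lemma exp_pi_eq_minus_1_iff:
  "exp (\<i> * of_real (x * pi)) = - 1 \<longleftrightarrow> (\<exists>z::int. x = 1 + 2 * of_int z)"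
proof -
  have "exp (\<i> * of_real ((x - 1) * pi)) = exp (\<i> * of_real (x * pi)) * exp (- (\<i> * of_real pi))"
    unfolding exp_add[symmetric] by (simp add: algebra_simps)
  also have "\<dots> = - exp (\<i> * of_real (x * pi))"
    by (simp add: exp_minus)
  finally have "exp (\<i> * of_real (x * pi)) = - 1 \<longleftrightarrow> exp (\<i> * of_real ((x - 1) * pi)) = 1"
    by (metis minus_minus minus_equation_iff)
  also have "\<dots> \<longleftrightarrow> (\<exists>z::int. x = 1 + 2 * of_int z)"
    unfolding exp_pi_eq_1_iff by (simp add: algebra_simps)
  finally show ?thesis .
qed

lemma exp_pi_eq_pm_1_iff:
  "exp (\<i> * of_real (x * pi)) = 1 \<or> exp (\<i> * of_real (x * pi)) = - 1 \<longleftrightarrow> x \<in> \<int>"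
proof
  assume "exp (\<i> * of_real (x * pi)) = 1 \<or> exp (\<i> * of_real (x * pi)) = - 1"
  then show "x \<in> \<int>" unfolding exp_pi_eq_1_iff exp_pi_eq_minus_1_iff by auto
next
  assume "x \<in> \<int>"
  then obtain w :: int where w: "x = of_int w" by (auto elim: Ints_cases)
  have "w = 2 * (w div 2) \<or> w = 1 + 2 * (w div 2)" by presburger
  then have "x = 2 * of_int (w div 2) \<or> x = 1 + 2 * of_int (w div 2)"
    unfolding w by (metis of_int_add of_int_mult of_int_numeral of_int_1)
  then show "exp (\<i> * of_real (x * pi)) = 1 \<or> exp (\<i> * of_real (x * pi)) = - 1"
    unfolding exp_pi_eq_1_iff exp_pi_eq_minus_1_iff by blast
qed

text \<open>Odd factors are coprime to powers of 2, so the same powers of 2 divide \<open>a\<close>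
  and \<open>b\<close>.\<close>

lemma multiplicity_2_odd_cofactors:
  fixes a b :: nat and u v :: int
  assumes "odd u" "odd v" "u * int a = v * int b" "a > 0" "b > 0"
  shows "multiplicity 2 a = multiplicity 2 b"
proof -
  have "2 ^ e dvd a \<longleftrightarrow> 2 ^ e dvd b" for e
  proof -
    have cop: "coprime (2 ^ e) u" "coprime (2 ^ e) v" using assms(1,2) by simp_all
    have "2 ^ e dvd a \<longleftrightarrow> 2 ^ e dvd u * int a"
      using cop by (simp add: coprime_dvd_mult_right_iff flip: int_dvd_int_iff)
    also have "\<dots> \<longleftrightarrow> 2 ^ e dvd b"
      unfolding assms(3) using cop by (simp add: coprime_dvd_mult_right_iff flip: int_dvd_int_iff)
    finally show ?thesis .
  qed
  then have "e \<le> multiplicity 2 a \<longleftrightarrow> e \<le> multiplicity 2 b" for e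
    using assms(4,5) by (simp add: power_dvd_iff_le_multiplicity)
  then show ?thesis by (meson le_antisym order_refl)
qed

text \<open>The arithmetic core, to be used with \<open>a k\<close> = |\<chi>(T)| and
  \<open>m k\<close> the difference of the second and the \<open>2 * k\<close>-th eigenvalue. With
  \<open>s = t / pi\<close>, the left side says that every \<open>s * 2 * a k\<close> is an odd
  integer and every \<open>s * m k\<close> an integer; the right side says the same through the gcd
  \<open>D\<close> of all \<open>2 * a k\<close> and \<open>m k\<close>.\<close>

lemma pst_time_iff:
  fixes a m :: "nat \<Rightarrow> nat" and t :: real
  assumes j: "j \<in> I" and a: "\<And>k. k \<in> I \<Longrightarrow> a k > 0"
  shows "(\<forall>k\<in>I. exp (\<i> * of_real (t * (2 * real (a k)))) = - 1 \<and>
        (exp (\<i> * of_real (t * real (m k))) = 1 \<or> exp (\<i> * of_real (t * real (m k))) = - 1)) \<longleftrightarrow>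
     (\<forall>k\<in>I. multiplicity 2 (a k) = multiplicity 2 (a j)) \<and>
     (Gcd (m ` I) > 0 \<longrightarrow> multiplicity 2 (Gcd (m ` I)) > multiplicity 2 (a j)) \<and>
     (\<exists>z::int. t = (1 + 2 * of_int z) * pi / real (gcd (2 * Gcd (a ` I)) (Gcd (m ` I))))"
    (is "?L \<longleftrightarrow> ?R")
proof -
  define s where "s = t / pi"
  define D where "D = gcd (2 * Gcd (a ` I)) (Gcd (m ` I))"
  let ?e = "multiplicity 2 (a j)"
  have ts: "t * x = (s * x) * pi" for x by (simp add: s_def)
  have Da: "D dvd 2 * a k" if "k \<in> I" for k
    using that unfolding D_def by (meson Gcd_dvd dvd_trans gcd_dvd1 imageI mult_dvd_mono dvd_refl)
  have Dm: "D dvd m k" if "k \<in> I" for k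
    using that unfolding D_def by (meson Gcd_dvd dvd_trans gcd_dvd2 imageI)
  have D0: "D > 0" using Da[OF j] a[OF j] by (auto intro: Nat.gr0I)
  have L: "?L \<longleftrightarrow> (\<forall>k\<in>I. (\<exists>z::int. s * (2 * real (a k)) = 1 + 2 * of_int z) \<and>
      s * real (m k) \<in> \<int>)"
    unfolding ts exp_pi_eq_pm_1_iff unfolding exp_pi_eq_minus_1_iff ..
  have T: "(\<exists>z::int. t = (1 + 2 * of_int z) * pi / real D) \<longleftrightarrow>
      (\<exists>z::int. s * real D = 1 + 2 * of_int z)"
    using D0 by (simp add: s_def field_simps)
  show ?thesis
    unfolding L D_def[symmetric] T
  proof (intro iffI conjI ballI impI)
    assume H: "\<forall>k\<in>I. (\<exists>z::int. s * (2 * real (a k)) = 1 + 2 * of_int z) \<and> s * real (m k) \<in> \<int>"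
    obtain z where z: "s * (2 * real (a j)) = 1 + 2 * of_int z" using H j by blast
    let ?w = "1 + 2 * z"
    have w: "s * (2 * real (a j)) = of_int ?w" using z by simp
    have aj: "real (a j) > 0" using a[OF j] by simp
    have s: "s = of_int ?w / (2 * real (a j))" using w aj by (simp add: field_simps)
    show "multiplicity 2 (a k) = ?e" if k: "k \<in> I" for k
    proof -
      obtain z' where z': "s * (2 * real (a k)) = 1 + 2 * of_int z'" using H k by blast
      then have "real_of_int (?w * int (a k)) = real_of_int ((1 + 2 * z') * int (a j))"
        using aj unfolding s by (simp add: field_simps)
      then have "?w * int (a k) = (1 + 2 * z') * int (a j)" by (simp only: of_int_eq_iff)
      then show ?thesis using a[OF k] a[OF j] by (intro multiplicity_2_odd_cofactors) simp_all
    qed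
    \<comment> \<open>Eliminating \<open>s\<close> gives an odd multiple of \<open>m k\<close> that
      is a multiple of \<open>2 * a j\<close>.\<close>
    have "2 ^ Suc ?e dvd m k" if k: "k \<in> I" for k
    proof -
      obtain x :: int where "s * real (m k) = of_int x" using H k by (auto elim: Ints_cases)
      then have "real_of_int (?w * int (m k)) = real_of_int (2 * int (a j) * x)"
        using aj unfolding s by (simp add: field_simps)
      then have eq: "?w * int (m k) = 2 * int (a j) * x" by (simp only: of_int_eq_iff)
      have "2 ^ Suc ?e dvd 2 * a j" by (simp add: multiplicity_dvd)
      then have "2 ^ Suc ?e dvd 2 * int (a j)"
        by (metis int_dvd_int_iff of_nat_mult of_nat_numeral of_nat_power)
      then have "2 ^ Suc ?e dvd ?w * int (m k)" unfolding eq by (rule dvd_mult2)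
      moreover have "coprime (2 ^ Suc ?e) ?w"
        by (simp add: coprime_power_left_iff del: power_Suc)
      ultimately have "2 ^ Suc ?e dvd int (m k)" by (simp only: coprime_dvd_mult_right_iff)
      then show ?thesis by (metis int_dvd_int_iff of_nat_numeral of_nat_power)
    qed
    then have G: "2 ^ Suc ?e dvd Gcd (m ` I)" by (intro Gcd_greatest) auto
    show "?e < multiplicity 2 (Gcd (m ` I))" if "Gcd (m ` I) > 0"
      using multiplicity_geI[OF gr_implies_not0[OF that] _ G] by simp
    \<comment> \<open>The reduced denominator of \<open>s\<close> divides each
      \<open>2 * a k\<close> and each \<open>m k\<close>, hence \<open>D\<close>; so
      \<open>s * D\<close> is an integer.\<close>
    have "s \<in> \<rat>" unfolding s by simp
    then obtain p q :: int where pq: "q > 0" "coprime p q" "s = of_int p / of_int q"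
      by (rule Rats_cases')
    have dvd: "nat q dvd x" if sx: "s * real x \<in> \<int>" for x
    proof -
      obtain y :: int where "s * real x = of_int y" using sx by (auto elim: Ints_cases)
      then have "real_of_int (p * int x) = real_of_int (q * y)"
        using pq(1,3) by (simp add: field_simps)
      then have "p * int x = q * y" by (simp only: of_int_eq_iff)
      then have "q dvd int x"
        using pq(2) by (metis coprime_commute coprime_dvd_mult_right_iff dvd_triv_left)
      then show ?thesis using pq(1) by (simp add: nat_dvd_iff)
    qed
    have "nat q dvd 2 * a k" if k: "k \<in> I" for k
    proof (rule dvd)
      obtain z' where "s * (2 * real (a k)) = 1 + 2 * of_int z'" using H k by blast
      then have "s * real (2 * a k) = of_int (1 + 2 * z')" by simp
      then show "s * real (2 * a k) \<in> \<int>" by (simp only: Ints_of_int)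
    qed
    then have "nat q dvd Gcd ((*) 2 ` a ` I)" by (intro Gcd_greatest) auto
    then have "nat q dvd 2 * Gcd (a ` I)" by (simp add: Gcd_mult)
    moreover have "nat q dvd Gcd (m ` I)" using H dvd by (intro Gcd_greatest) auto
    ultimately have "nat q dvd D" unfolding D_def by (rule gcd_greatest)
    then obtain x where x: "D = nat q * x" ..
    have sD: "s * real D = of_int (p * int x)" using pq(1,3) by (simp add: x)
    obtain y where y: "2 * a j = D * y" using Da[OF j] ..
    \<comment> \<open>The odd number \<open>?w\<close> is an integer multiple of
      \<open>s * D\<close>, which must therefore be odd.\<close>
    have "real_of_int ?w = s * real (2 * a j)" using w by simp
    also have "\<dots> = of_int (p * int x * int y)" unfolding y using sD by simp
    finally have "?w = p * int x * int y" by (simp only: of_int_eq_iff)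
    then have "odd (p * int x)" by (metis dvd_mult2 dvd_triv_left even_plus_one_iff add.commute)
    then obtain z' where "p * int x = 2 * z' + 1" by (rule oddE)
    then have "s * real D = 1 + 2 * of_int z'" unfolding sD by simp
    then show "\<exists>z::int. s * real D = 1 + 2 * of_int z" ..
  next
    assume H: "(\<forall>k\<in>I. multiplicity 2 (a k) = ?e) \<and>
      (Gcd (m ` I) > 0 \<longrightarrow> multiplicity 2 (Gcd (m ` I)) > ?e) \<and>
      (\<exists>z::int. s * real D = 1 + 2 * of_int z)"
    then obtain z where z: "s * real D = 1 + 2 * of_int z" by blast
    fix k assume k: "k \<in> I"
    obtain y where y: "m k = D * y" using Dm[OF k] ..
    have "s * real (m k) = of_int ((1 + 2 * z) * int y)" unfolding y using z by simp
    then show "s * real (m k) \<in> \<int>" by (simp only: Ints_of_int)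
    obtain x where x: "2 * a k = D * x" using Da[OF k] ..
    have "2 ^ ?e dvd Gcd (a ` I)"
      using H by (intro Gcd_greatest) (auto simp: multiplicity_dvd' )
    then have "2 ^ Suc ?e dvd 2 * Gcd (a ` I)" by simp
    \<comment> \<open>If all \<open>m k\<close> vanish, the gcd is 0 and the divisibility is
      trivial.\<close>
    moreover have "2 ^ Suc ?e dvd Gcd (m ` I)"
    proof (cases "Gcd (m ` I) = 0")
      case True
      then show ?thesis by (simp only: dvd_0_right)
    next
      case False
      then have "Gcd (m ` I) > 0" by (rule neq0_conv[THEN iffD1])
      with H have "?e < multiplicity 2 (Gcd (m ` I))" by blast
      then show ?thesis by (intro multiplicity_dvd' Suc_leI)
    qed
    ultimately have D2: "2 ^ Suc ?e dvd D" unfolding D_def by (rule gcd_greatest)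
    \<comment> \<open>\<open>D\<close> already contains the full power of 2 in
      \<open>2 * a k\<close>, so the cofactor is odd.\<close>
    have "odd x"
    proof
      assume "even x"
      then have "2 ^ Suc ?e * 2 dvd 2 * a k" unfolding x using D2 by (rule mult_dvd_mono[rotated])
      then have "2 ^ Suc ?e dvd a k" by simp
      then have "Suc ?e \<le> multiplicity 2 (a k)"
        using a[OF k] by (simp add: power_dvd_iff_le_multiplicity del: power_Suc)
      then show False using H k by simp
    qed
    then have "odd ((1 + 2 * z) * int x)" by simp
    then obtain z' where z': "(1 + 2 * z) * int x = 2 * z' + 1" by (rule oddE)
    have "s * (2 * real (a k)) = s * real (2 * a k)" by simp
    also have "\<dots> = of_int ((1 + 2 * z) * int x)" unfolding x using z by simp
    finally have "s * (2 * real (a k)) = 1 + 2 * of_int z'" unfolding z' by simp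
    then show "\<exists>z::int. s * (2 * real (a k)) = 1 + 2 * of_int z" ..
  qed
qed

section \<open>Perfect state transfer between the parts\<close>

lemma char_sum_one [simp]: "char_sum (\<lambda>_. 1) S = of_nat (card S)"
  by (simp add: char_sum_def)

lemma norm_char_sum_le:
  fixes c :: "'a::{finite,ab_group_add} \<Rightarrow> complex"
  assumes "character c" shows "norm (char_sum c S) \<le> real (card S)"
  using norm_sum[of c S] by (simp add: char_sum_def norm_character[OF assms])

lemma char_sum_cnj: "char_sum (\<lambda>g. cnj (c g)) S = cnj (char_sum c S)"
  by (simp add: char_sum_def)

text \<open>The block is now \<chi>(R) times the identity plus an off-diagonal Hermitian part with
  eigenvalues \<plusminus>|\<chi>(T)|. The eigenvector is nonzero because its entry at
  \<open>Inl 0\<close> is \<chi>(T).\<close>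

lemma eigenvalue_bicay_equal_parts:
  fixes R T :: "'a::{finite,ab_group_add} set"
  assumes R: "uminus ` R = R" and c: "character c" and T: "char_sum c T \<noteq> 0"
    and s: "s = norm (char_sum c T) \<or> s = - norm (char_sum c T)"
  shows "eigenvalue (adjacency_matrix (bicay R R T)) (of_real (Re (char_sum c R) + s))"
  unfolding eigenvalue_def
proof (intro exI conjI)
  define r where "r = Re (char_sum c R)"
  have r: "char_sum c R = of_real r" using char_sum_real[OF c R] by (simp add: r_def)
  have "s\<^sup>2 = (norm (char_sum c T))\<^sup>2" using s by auto
  then have s2: "char_sum c T * cnj (char_sum c T) = complex_of_real s * of_real s"
    using complex_norm_square[of "char_sum c T"]
    by (metis of_real_mult power2_eq_square)
  show "bicay_vec (char_sum c T) (of_real s) c \<noteq> 0"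
    using T character_zero[OF c] by (auto simp: vec_sum_type_eq_iff intro!: exI[of _ 0])
  show "adjacency_matrix (bicay R R T) *v bicay_vec (char_sum c T) (of_real s) c
      = of_real (Re (char_sum c R) + s) *s bicay_vec (char_sum c T) (of_real s) c"
    unfolding r_def[symmetric]
    by (rule adjacency_bicay_eigenvector[OF R R c]) (simp_all add: r s2 algebra_simps)
qed

text \<open>The number |\<chi>(T)| is itself an eigenvalue of the bipartite graph with empty
  connection sets inside the parts, so rationality suffices. This separates it from
  \<chi>(R).\<close>

lemma norm_char_sum_int:
  fixes T :: "'a::{finite,ab_group_add} set"
  assumes "character c" "char_sum c T \<noteq> 0" "norm (char_sum c T) \<in> \<rat>"
  shows "norm (char_sum c T) \<in> \<int>"
proof -
  have "eigenvalue (adjacency_matrix (bicay {} {} T)) (of_real (norm (char_sum c T)))"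
    using eigenvalue_bicay_equal_parts[of "{}" c T "norm (char_sum c T)"] assms(1,2)
    by (simp add: char_sum_def)
  moreover have "complex_of_real (norm (char_sum c T)) \<in> \<rat>"
    using assms(3) by (auto elim!: Rats_cases)
  ultimately show ?thesis
    using integer_eigenvalue_adjacency_matrix by (metis of_real_in_Ints_iff)
qed

context all_characters
begin

text \<open>Completeness of the spectrum, since integrality concerns every eigenvalue. By Fourier
  inversion some pair of Fourier coefficients of an eigenvector is nonzero, and that pair is an
  eigenvector of the block.\<close>

lemma eigenvalue_bicay_equal_parts_cases:
  assumes R: "uminus ` R = R" and ev: "eigenvalue (adjacency_matrix (bicay R R T)) \<mu>"
  obtains k where "k \<in> {1..CARD('a)}"
    "\<mu> = char_sum (chi k) R + of_real (norm (char_sum (chi k) T)) \<or>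
     \<mu> = char_sum (chi k) R - of_real (norm (char_sum (chi k) T))"
proof -
  obtain x where x: "x \<noteq> 0" "adjacency_matrix (bicay R R T) *v x = \<mu> *s x"
    using ev by (auto simp: eigenvalue_def)
  define a b where ab: "a k = (\<Sum>h\<in>UNIV. cnj (chi k h) * x $ Inl h)"
    "b k = (\<Sum>h\<in>UNIV. cnj (chi k h) * x $ Inr h)" for k
  have "\<exists>k\<in>{1..CARD('a)}. a k \<noteq> 0 \<or> b k \<noteq> 0"
  proof (rule ccontr)
    assume "\<not> ?thesis"
    then have "of_nat CARD('a) * x $ Inl g = 0" "of_nat CARD('a) * x $ Inr g = 0" for g
      unfolding fourier_inversion[of "\<lambda>h. x $ Inl h" g, symmetric]
        fourier_inversion[of "\<lambda>h. x $ Inr h" g, symmetric] ab[symmetric] by simp_all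
    then show False using x(1) by (simp add: vec_sum_type_eq_iff)
  qed
  then obtain k where k: "k \<in> {1..CARD('a)}" and nz: "a k \<noteq> 0 \<or> b k \<noteq> 0" by blast
  note c = character_chi[OF k]
  let ?r = "char_sum (chi k) R" and ?t = "char_sum (chi k) T"
  \<comment> \<open>Fourier coefficients turn sums over translates into multiplication by a
    character sum.\<close>
  have shift: "(\<Sum>h\<in>UNIV. cnj (chi k h) * (\<Sum>s\<in>S. f (h + s)))
      = char_sum (chi k) S * (\<Sum>h\<in>UNIV. cnj (chi k h) * f h)"
    "(\<Sum>h\<in>UNIV. cnj (chi k h) * (\<Sum>s\<in>S. f (h - s)))
      = cnj (char_sum (chi k) S) * (\<Sum>h\<in>UNIV. cnj (chi k h) * f h)" for f and S :: "'a set"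
  proof -
    have "(\<Sum>h\<in>UNIV. cnj (chi k h) * f (h + s)) = (\<Sum>h\<in>UNIV. cnj (chi k (h - s)) * f h)"
      "(\<Sum>h\<in>UNIV. cnj (chi k h) * f (h - s)) = (\<Sum>h\<in>UNIV. cnj (chi k (h + s)) * f h)" for s
      by (rule sum.reindex_bij_witness[of _ "\<lambda>h. h - s" "\<lambda>h. h + s"]; simp)
        (rule sum.reindex_bij_witness[of _ "\<lambda>h. h + s" "\<lambda>h. h - s"]; simp)
    note translate = this
    have swap: "(\<Sum>h\<in>UNIV. cnj (chi k h) * (\<Sum>s\<in>S. F h s))
        = (\<Sum>s\<in>S. \<Sum>h\<in>UNIV. cnj (chi k h) * F h s)" for F
      unfolding sum_distrib_left by (rule sum.swap)
    show "(\<Sum>h\<in>UNIV. cnj (chi k h) * (\<Sum>s\<in>S. f (h + s)))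
        = char_sum (chi k) S * (\<Sum>h\<in>UNIV. cnj (chi k h) * f h)"
      unfolding swap translate char_sum_def sum_product
      by (simp add: character_diff[OF c] mult_ac)
    show "(\<Sum>h\<in>UNIV. cnj (chi k h) * (\<Sum>s\<in>S. f (h - s)))
        = cnj (char_sum (chi k) S) * (\<Sum>h\<in>UNIV. cnj (chi k h) * f h)"
      unfolding swap translate char_sum_def cnj_sum sum_product
      by (simp add: character_add[OF c] mult_ac)
  qed
  have "?r * a k + ?t * b k
      = (\<Sum>h\<in>UNIV. cnj (chi k h) * (adjacency_matrix (bicay R R T) *v x) $ Inl h)"
    by (simp add: adjacency_bicay_mult[OF R R] distrib_left sum.distrib ab
        shift[where f = "\<lambda>h. x $ Inl h"] shift[where f = "\<lambda>h. x $ Inr h"])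
  also have "\<dots> = \<mu> * a k"
    by (simp add: x(2) ab sum_distrib_left mult_ac)
  finally have 1: "?t * b k = (\<mu> - ?r) * a k" by (simp add: algebra_simps)
  have "cnj ?t * a k + ?r * b k
      = (\<Sum>h\<in>UNIV. cnj (chi k h) * (adjacency_matrix (bicay R R T) *v x) $ Inr h)"
    by (simp add: adjacency_bicay_mult[OF R R] distrib_left sum.distrib ab
        shift[where f = "\<lambda>h. x $ Inl h"] shift[where f = "\<lambda>h. x $ Inr h"])
  also have "\<dots> = \<mu> * b k"
    by (simp add: x(2) ab sum_distrib_left mult_ac)
  finally have 2: "cnj ?t * a k = (\<mu> - ?r) * b k" by (simp add: algebra_simps)
  have "(\<mu> - ?r) * (\<mu> - ?r) * a k = ?t * cnj ?t * a k"
    "(\<mu> - ?r) * (\<mu> - ?r) * b k = ?t * cnj ?t * b k"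
    using 1 2 by algebra+
  then have "(\<mu> - ?r)\<^sup>2 = (of_real (norm ?t))\<^sup>2"
    using nz complex_norm_square[of ?t] by (auto simp: power2_eq_square)
  then have "\<mu> - ?r = of_real (norm ?t) \<or> \<mu> - ?r = - of_real (norm ?t)"
    by (simp only: power2_eq_iff)
  then have "\<mu> = ?r + of_real (norm ?t) \<or> \<mu> = ?r - of_real (norm ?t)"
    by (auto simp: algebra_simps)
  then show thesis using that k by blast
qed

text \<open>The average of numbers in the unit disc has modulus 1 iff all have modulus 1 and agree
  with the one for the principal character. There \<chi>(R) and \<chi>(T) are cardinalities, which
  gives the explicit phase on the right.\<close>

lemma bicay_pst_iff:
  assumes RL: "uminus ` R = R" "uminus ` L = L" and one: "chi 1 = (\<lambda>_. 1)"
  shows "perfect_state_transfer (bicay R L T) (Inl p) (Inr q) t \<longleftrightarrow>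
    R = L \<and> (\<forall>k\<in>{1..CARD('a)}. char_sum (chi k) T \<noteq> 0 \<and>
      exp (\<i> * of_real (t * (2 * norm (char_sum (chi k) T)))) = - 1 \<and>
      chi k (p - q) * (char_sum (chi k) T / norm (char_sum (chi k) T)) =
        exp (- \<i> * of_real (t * (real (card R) + real (card T) -
          (Re (char_sum (chi k) R) + norm (char_sum (chi k) T))))))"
    (is "?P \<longleftrightarrow> R = L \<and> (\<forall>k\<in>?I. ?C k)")
proof -
  let ?f = "\<lambda>k. transfer_coeff (chi k) R L T t"
  let ?z = "\<lambda>k. chi k (p - q) * ?f k"
  have I: "1 \<in> ?I" by (simp add: Suc_le_eq)
  have nz: "norm (?z k) = norm (?f k)" if "k \<in> ?I" for k
    using norm_character[OF character_chi[OF that]] by (simp add: norm_mult)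
  have "?P \<longleftrightarrow> norm (of_nat CARD('a) * transfer_matrix (bicay R L T) t $ Inl p $ Inr q) = real (card ?I)"
    by (simp add: perfect_state_transfer_def norm_mult)
  also have "\<dots> \<longleftrightarrow> norm (\<Sum>k\<in>?I. ?z k) = real (card ?I)"
    by (simp only: transfer_bicay_entry[OF RL])
  also have "\<dots> \<longleftrightarrow> norm (?z 1) = 1 \<and> (\<forall>k\<in>?I. ?z k = ?z 1)"
    using I nz norm_transfer_coeff_le by (intro norm_sum_eq_card_iff) simp_all
  also have "\<dots> \<longleftrightarrow> (\<forall>k\<in>?I. norm (?f k) = 1 \<and> ?z k = ?z 1)"
    using nz I by metis
  finally have P: "?P \<longleftrightarrow> (\<forall>k\<in>?I. norm (?f k) = 1 \<and> ?z k = ?z 1)" .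
  have z: "?z k = ?z 1 \<longleftrightarrow> chi k (p - q) * (char_sum (chi k) T / norm (char_sum (chi k) T)) =
        exp (- \<i> * of_real (t * (real (card R) + real (card T) -
          (Re (char_sum (chi k) R) + norm (char_sum (chi k) T)))))"
    if k: "k \<in> ?I" and all: "\<forall>k\<in>?I. norm (?f k) = 1" for k
  proof -
    have f: "?f k = char_sum (chi k) T / norm (char_sum (chi k) T) *
        exp (- \<i> * of_real (t * (Re (char_sum (chi k) R) + norm (char_sum (chi k) T))))"
      if "k \<in> ?I" for k
      using all that norm_transfer_coeff_eq_1[of "chi k" R L T t]
      by (intro transfer_coeff_eq) simp_all
    \<comment> \<open>Needed for the factor \<chi>(T) / |\<chi>(T)| of the principal character to be
      1 and not 0 / 0.\<close>
    have "T \<noteq> {}"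
      using all I norm_transfer_coeff_eq_1[of "chi 1" R L T t] by (auto simp: char_sum_def)
    then have z1: "?z 1 = exp (- \<i> * of_real (t * (real (card R) + real (card T))))"
      using f[OF I] by (simp add: one[unfolded One_nat_def])
    define \<alpha> \<beta> where "\<alpha> = Re (char_sum (chi k) R) + norm (char_sum (chi k) T)"
      and "\<beta> = real (card R) + real (card T)"
    have "exp (- \<i> * of_real (t * \<beta>))
        = exp (- \<i> * of_real (t * (\<beta> - \<alpha>))) * exp (- \<i> * of_real (t * \<alpha>))"
      unfolding exp_add[symmetric] by (rule arg_cong[of _ _ exp]) (simp add: algebra_simps)
    then show ?thesis
      unfolding z1 f[OF k] \<alpha>_def[symmetric] \<beta>_def[symmetric]
      by (simp only: mult.assoc[symmetric] mult_right_cancel[OF exp_not_eq_zero])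
  qed
  show ?thesis
  proof
    assume ?P
    then have H: "\<forall>k\<in>?I. norm (?f k) = 1 \<and> ?z k = ?z 1" by (simp only: P)
    then have all: "\<forall>k\<in>?I. norm (?f k) = 1" by (rule ball_conj_distrib[THEN iffD1, THEN conjunct1])
    from H have eq: "\<forall>k\<in>?I. ?z k = ?z 1" by (rule ball_conj_distrib[THEN iffD1, THEN conjunct2])
    have "R = L"
    proof (rule char_sum_determines_set)
      fix k assume k: "k \<in> ?I"
      then have "Re (char_sum (chi k) R) = Re (char_sum (chi k) L)"
        using all norm_transfer_coeff_eq_1[of "chi k" R L T t] by simp
      then show "char_sum (chi k) R = char_sum (chi k) L"
        by (metis char_sum_real[OF character_chi[OF k] RL(1)]
            char_sum_real[OF character_chi[OF k] RL(2)])
    qed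
    moreover have "?C k" if k: "k \<in> ?I" for k
    proof -
      have "norm (?f k) = 1" "?z k = ?z 1" using all eq k by blast+
      then show ?thesis unfolding norm_transfer_coeff_eq_1 z[OF k all] by blast
    qed
    ultimately show "R = L \<and> (\<forall>k\<in>?I. ?C k)" by blast
  next
    assume H: "R = L \<and> (\<forall>k\<in>?I. ?C k)"
    then have all: "\<forall>k\<in>?I. norm (?f k) = 1"
      unfolding norm_transfer_coeff_eq_1 by blast
    have "norm (?f k) = 1 \<and> ?z k = ?z 1" if "k \<in> ?I" for k
      unfolding z[OF that all] using all H that by blast
    then show ?P unfolding P by blast
  qed
qed

text \<open>Replacing a character by its conjugate conjugates the left-hand side of the phase equation
  but leaves the right-hand side alone, so the phase is real.\<close>

lemma bicay_pst_phase:
  assumes RL: "uminus ` R = R" "uminus ` L = L" and one: "chi 1 = (\<lambda>_. 1)"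
    and pst: "perfect_state_transfer (bicay R L T) (Inl p) (Inr q) t" and k: "k \<in> {1..CARD('a)}"
  defines "\<theta> \<equiv> t * (real (card R) + real (card T) -
          (Re (char_sum (chi k) R) + norm (char_sum (chi k) T)))"
  shows "exp (\<i> * of_real \<theta>) = 1 \<or> exp (\<i> * of_real \<theta>) = - 1"
proof -
  obtain k' where k': "k' \<in> {1..CARD('a)}" "(\<lambda>g. cnj (chi k g)) = chi k'"
    using character_cases[OF character_cnj[OF character_chi[OF k]]] .
  have c: "chi k' g = cnj (chi k g)" "char_sum (chi k') S = cnj (char_sum (chi k) S)" for g S
    using k'(2)[symmetric] by (simp_all add: char_sum_cnj)
  have C: "chi j (p - q) * (char_sum (chi j) T / norm (char_sum (chi j) T)) =
        exp (- \<i> * of_real (t * (real (card R) + real (card T) -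
          (Re (char_sum (chi j) R) + norm (char_sum (chi j) T)))))" if "j \<in> {1..CARD('a)}" for j
    using pst that unfolding bicay_pst_iff[OF RL one] by blast
  define x where "x = chi k (p - q) * (char_sum (chi k) T / norm (char_sum (chi k) T))"
  have x: "x = exp (- \<i> * of_real \<theta>)" using C[OF k] by (simp only: x_def \<theta>_def)
  have "cnj x = exp (- \<i> * of_real \<theta>)" using C[OF k'(1)] unfolding c by (simp add: x_def \<theta>_def)
  moreover have "cnj x = exp (\<i> * of_real \<theta>)" unfolding x by (simp add: exp_cnj)
  ultimately have "exp (\<i> * of_real \<theta>) = exp (- \<i> * of_real \<theta>)" by metis
  moreover have "exp (\<i> * of_real \<theta>) * exp (- \<i> * of_real \<theta>) = 1"
    unfolding exp_add[symmetric] by simp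
  ultimately have "(exp (\<i> * of_real \<theta>))\<^sup>2 = 1" by (metis power2_eq_square)
  then show ?thesis by (simp only: power2_eq_1_iff)
qed

text \<open>The principal character makes \<open>s * 2 * card T\<close> odd for
  \<open>s = t / pi\<close>, so \<open>s\<close> is a nonzero rational. The remaining conditions
  then make |\<chi>(T)| and the eigenvalues rational, hence integral.\<close>

lemma bicay_pst_integral:
  assumes RL: "uminus ` R = R" "uminus ` L = L" and one: "chi 1 = (\<lambda>_. 1)"
    and pst: "perfect_state_transfer (bicay R L T) (Inl p) (Inr q) t" and k: "k \<in> {1..CARD('a)}"
  shows "R = L" "char_sum (chi k) T \<noteq> 0" "norm (char_sum (chi k) T) \<in> \<int>"
    "Re (char_sum (chi k) R) \<in> \<int>"
proof -
  note c = character_chi[OF k]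
  note PST = pst[unfolded bicay_pst_iff[OF RL one]]
  show RL': "R = L" and T: "char_sum (chi k) T \<noteq> 0" using PST k by blast+
  have I: "1 \<in> {1..CARD('a)}" by (simp add: Suc_le_eq)
  define s where "s = t / pi"
  have ts: "t * x = (s * x) * pi" for x by (simp add: s_def)
  have odd: "\<exists>z::int. s * (2 * norm (char_sum (chi j) T)) = 1 + 2 * of_int z"
    if "j \<in> {1..CARD('a)}" for j
  proof -
    have "exp (\<i> * of_real (t * (2 * norm (char_sum (chi j) T)))) = - 1" using PST that by blast
    then show ?thesis unfolding ts exp_pi_eq_minus_1_iff .
  qed
  obtain z1 :: int where z1: "s * (2 * real (card T)) = 1 + 2 * of_int z1"
    using odd[OF I] by (auto simp: one[unfolded One_nat_def])
  have "1 + 2 * z1 \<noteq> 0" by presburger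
  then have w0: "real_of_int (1 + 2 * z1) \<noteq> 0" by (simp only: of_int_eq_0_iff not_False_eq_True)
  then have T0: "real (card T) \<noteq> 0" using z1 by auto
  have s: "s = of_int (1 + 2 * z1) / (2 * real (card T))"
    using z1 T0 by (simp add: field_simps)
  then have s0: "s \<noteq> 0" and sQ: "s \<in> \<rat>" using T0 w0 by auto
  have rat: "x \<in> \<rat>" if "s * x \<in> \<rat>" for x
  proof -
    have "x = (s * x) / s" using s0 by simp
    then show ?thesis using Rats_divide[OF that sQ] by simp
  qed
  obtain z :: int where "s * (2 * norm (char_sum (chi k) T)) = 1 + 2 * of_int z"
    using odd[OF k] by blast
  then have "s * (2 * norm (char_sum (chi k) T)) = of_int (1 + 2 * z)" by simp
  then have "s * (2 * norm (char_sum (chi k) T)) \<in> \<rat>" by (simp only: Rats_of_int)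
  then have "2 * norm (char_sum (chi k) T) \<in> \<rat>" by (rule rat)
  then have "2 * norm (char_sum (chi k) T) / 2 \<in> \<rat>" by (rule Rats_divide) simp
  then have nQ: "norm (char_sum (chi k) T) \<in> \<rat>" by simp
  then show n: "norm (char_sum (chi k) T) \<in> \<int>" by (rule norm_char_sum_int[OF c T])
  define \<mu> where "\<mu> = Re (char_sum (chi k) R) + norm (char_sum (chi k) T)"
  have "s * (real (card R) + real (card T) - \<mu>) \<in> \<int>"
    using bicay_pst_phase[OF RL one pst k] unfolding ts exp_pi_eq_pm_1_iff \<mu>_def .
  then have "s * (real (card R) + real (card T) - \<mu>) \<in> \<rat>"
    using Ints_subset_Rats by (rule subsetD[rotated])
  then have "real (card R) + real (card T) - \<mu> \<in> \<rat>" by (rule rat)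
  moreover have "real (card R) + real (card T) \<in> \<rat>" by (intro Rats_add Rats_of_nat)
  ultimately have "\<mu> \<in> \<rat>"
    using Rats_diff[of "real (card R) + real (card T)" "real (card R) + real (card T) - \<mu>"]
    by simp
  then have "complex_of_real \<mu> \<in> \<rat>" by (auto elim!: Rats_cases)
  moreover have "eigenvalue (adjacency_matrix (bicay R R T)) (of_real \<mu>)"
    unfolding \<mu>_def using eigenvalue_bicay_equal_parts[OF RL(1) c T] by blast
  ultimately have "\<mu> \<in> \<int>"
    using integer_eigenvalue_adjacency_matrix by (metis of_real_in_Ints_iff)
  then have "\<mu> - norm (char_sum (chi k) T) \<in> \<int>" using n by simp
  then show "Re (char_sum (chi k) R) \<in> \<int>" by (simp add: \<mu>_def)
qed

lemma integral_graph_bicay_equal_parts_iff: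
  assumes R: "uminus ` R = R" and T: "\<And>k. k \<in> {1..CARD('a)} \<Longrightarrow> char_sum (chi k) T \<noteq> 0"
  shows "integral_graph (bicay R R T) \<longleftrightarrow>
    (\<forall>k\<in>{1..CARD('a)}. norm (char_sum (chi k) T) \<in> \<int> \<and> Re (char_sum (chi k) R) \<in> \<int>)"
proof (intro iffI ballI)
  fix k assume int: "integral_graph (bicay R R T)" and k: "k \<in> {1..CARD('a)}"
  let ?r = "Re (char_sum (chi k) R)" and ?n = "norm (char_sum (chi k) T)"
  have ev: "?r + s \<in> \<int>" if "s = ?n \<or> s = - ?n" for s
    using int eigenvalue_bicay_equal_parts[OF R character_chi[OF k] T[OF k] that]
    unfolding integral_graph_def by (metis of_real_in_Ints_iff)
  \<comment> \<open>The difference only shows that 2|\<chi>(T)| is an integer; rationality of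
    |\<chi>(T)| then gives integrality.\<close>
  have "(?r + ?n) - (?r + - ?n) \<in> \<int>"
    by (intro Ints_diff ev) simp_all
  then have "2 * ?n \<in> \<rat>" using Ints_subset_Rats by auto
  then have "2 * ?n / 2 \<in> \<rat>" by (rule Rats_divide) simp
  then have n: "?n \<in> \<int>" by (intro norm_char_sum_int[OF character_chi[OF k] T[OF k]]) simp
  moreover have "(?r + ?n) - ?n \<in> \<int>" by (intro Ints_diff ev n) simp
  ultimately show "?n \<in> \<int> \<and> ?r \<in> \<int>" by simp
next
  assume int: "\<forall>k\<in>{1..CARD('a)}. norm (char_sum (chi k) T) \<in> \<int> \<and> Re (char_sum (chi k) R) \<in> \<int>"
  show "integral_graph (bicay R R T)"
    unfolding integral_graph_def
  proof (intro allI impI)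
    fix \<mu> assume "eigenvalue (adjacency_matrix (bicay R R T)) \<mu>"
    then obtain k where k: "k \<in> {1..CARD('a)}"
      and \<mu>: "\<mu> = char_sum (chi k) R + of_real (norm (char_sum (chi k) T)) \<or>
        \<mu> = char_sum (chi k) R - of_real (norm (char_sum (chi k) T))"
      by (rule eigenvalue_bicay_equal_parts_cases[OF R])
    have "complex_of_real (Re (char_sum (chi k) R)) \<in> \<int>"
      "complex_of_real (norm (char_sum (chi k) T)) \<in> \<int>"
      using int k by (simp_all only: of_real_in_Ints_iff)
    then have "char_sum (chi k) R \<in> \<int>" "complex_of_real (norm (char_sum (chi k) T)) \<in> \<int>"
      by (simp_all only: char_sum_real[OF character_chi[OF k] R])
    then show "\<mu> \<in> \<int>" using \<mu> by auto
  qed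
qed

text \<open>With integral data the character criterion splits into the arithmetic of
  \<open>t\<close>, handled by \<open>pst_time_iff\<close>, and the values of the characters at
  \<open>p - q\<close>.\<close>

lemma bicay_integral_pst_iff:
  fixes a m :: "nat \<Rightarrow> nat"
  assumes R: "uminus ` R = R" and one: "chi 1 = (\<lambda>_. 1)"
    and T: "\<And>k. k \<in> {1..CARD('a)} \<Longrightarrow> char_sum (chi k) T \<noteq> 0"
    and a: "\<And>k. k \<in> {1..CARD('a)} \<Longrightarrow> norm (char_sum (chi k) T) = real (a k)"
    and m: "\<And>k. k \<in> {1..CARD('a)} \<Longrightarrow> real (card R) + real (card T) -
      (Re (char_sum (chi k) R) + norm (char_sum (chi k) T)) = real (m k)"
  defines "M \<equiv> Gcd (m ` {1..CARD('a)})" and "M\<^sub>T \<equiv> Gcd (a ` {1..CARD('a)})"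
  shows "perfect_state_transfer (bicay R R T) (Inl p) (Inr q) t \<longleftrightarrow>
    (\<forall>k\<in>{1..CARD('a)}.
      (exp (\<i> * of_real (t * real (m k))) = 1 \<longrightarrow>
         chi k (p - q) = of_real (norm (char_sum (chi k) T)) / char_sum (chi k) T) \<and>
      (exp (\<i> * of_real (t * real (m k))) = - 1 \<longrightarrow>
         chi k (p - q) = - (of_real (norm (char_sum (chi k) T)) / char_sum (chi k) T)) \<and>
      v2 (norm (char_sum (chi k) T)) = v2 (real (card T))) \<and>
    (M > 0 \<longrightarrow> v2 (real M) > v2 (real (card T))) \<and>
    (\<exists>z::int. t = (1 + 2 * of_int z) * pi / real (gcd (2 * M\<^sub>T) M))"
proof -
  let ?I = "{1..CARD('a)}"
  let ?x = "\<lambda>k. chi k (p - q) * (char_sum (chi k) T / norm (char_sum (chi k) T))"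
  let ?e = "\<lambda>k. exp (\<i> * of_real (t * real (m k)))"
  let ?A = "\<lambda>k. (?e k = 1 \<longrightarrow>
         chi k (p - q) = of_real (norm (char_sum (chi k) T)) / char_sum (chi k) T) \<and>
      (?e k = - 1 \<longrightarrow>
         chi k (p - q) = - (of_real (norm (char_sum (chi k) T)) / char_sum (chi k) T))"
  let ?H = "\<lambda>k. exp (\<i> * of_real (t * (2 * real (a k)))) = - 1"
  let ?S = "\<lambda>k. ?e k = 1 \<or> ?e k = - 1"
  have I: "1 \<in> ?I" by (simp add: Suc_le_eq)
  have a0: "a k > 0" if "k \<in> ?I" for k
    using T[OF that] a[OF that] by (metis norm_eq_zero of_nat_0 gr0I)
  have a1: "a 1 = card T" using a[OF I] by (simp add: one[unfolded One_nat_def])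
  have v2a: "v2 (real (a k)) = ereal (real (multiplicity 2 (a k)))" if "k \<in> ?I" for k
    using v2_nat a0[OF that] .
  have v2T: "v2 (real (card T)) = ereal (real (multiplicity 2 (a 1)))"
    using v2a[OF I] by (simp only: a1)
  have e_minus: "exp (- \<i> * of_real (t * real (m k))) = inverse (?e k)" for k
    by (simp add: exp_minus)
  \<comment> \<open>The two implications in \<open>?A\<close> determine the phase only if
    \<open>?e k\<close> is \<plusminus>1. Perfect state transfer ensures this in one direction, the
    conditions on \<open>t\<close> in the other.\<close>
  have A: "?A k \<longleftrightarrow> ?x k = exp (- \<i> * of_real (t * real (m k)))" if "k \<in> ?I" "?S k" for k
  proof -
    have "?x k = 1 \<longleftrightarrow> chi k (p - q) = of_real (norm (char_sum (chi k) T)) / char_sum (chi k) T"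
      "?x k = - 1 \<longleftrightarrow> chi k (p - q) = - (of_real (norm (char_sum (chi k) T)) / char_sum (chi k) T)"
      using T[OF that(1)] by (simp_all add: field_simps)
    then show ?thesis unfolding e_minus using that(2) by auto
  qed
  have "perfect_state_transfer (bicay R R T) (Inl p) (Inr q) t \<longleftrightarrow>
      (\<forall>k\<in>?I. ?H k \<and> ?x k = exp (- \<i> * of_real (t * real (m k))))" (is "?P \<longleftrightarrow> _")
    unfolding bicay_pst_iff[OF R R one] using T by (simp add: m a[symmetric])
  also have "\<dots> \<longleftrightarrow> (\<forall>k\<in>?I. ?H k \<and> ?S k) \<and> (\<forall>k\<in>?I. ?A k)"
  proof -
    have "?S k" if "?P" "k \<in> ?I" for k
      using bicay_pst_phase[OF R R one that] unfolding m[OF that(2)] .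
    then show ?thesis using A calculation by blast
  qed
  also have "(\<forall>k\<in>?I. ?H k \<and> ?S k) \<longleftrightarrow>
      (\<forall>k\<in>?I. v2 (real (a k)) = v2 (real (card T))) \<and>
      (M > 0 \<longrightarrow> v2 (real M) > v2 (real (card T))) \<and>
      (\<exists>z::int. t = (1 + 2 * of_int z) * pi / real (gcd (2 * M\<^sub>T) M))"
  proof -
    have "(\<forall>k\<in>?I. ?H k \<and> ?S k) \<longleftrightarrow>
        (\<forall>k\<in>?I. multiplicity 2 (a k) = multiplicity 2 (a 1)) \<and>
        (M > 0 \<longrightarrow> multiplicity 2 M > multiplicity 2 (a 1)) \<and>
        (\<exists>z::int. t = (1 + 2 * of_int z) * pi / real (gcd (2 * M\<^sub>T) M))"
      unfolding M_def M\<^sub>T_def by (rule pst_time_iff[OF I a0])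
    then show ?thesis using v2_nat[of M] v2a by (simp only: v2T) simp
  qed
  finally show ?thesis
    using a by auto
qed

end

theorem theorem4p7:
  fixes R L T :: "'a::{finite,ab_group_add} set"
    and chi :: "nat \<Rightarrow> 'a \<Rightarrow> complex"
    and n M M\<^sub>T :: nat
    and lam :: "nat \<Rightarrow> real"
    and g\<^sub>p g\<^sub>q d :: 'a
    and u v :: "'a + 'a"
    and t :: real
  assumes "n = CARD('a)"
    and "bij_betw chi {1..n} {c. character c}"
    and "chi 1 = (\<lambda>_. 1)"
    and "uminus ` R = R" and "uminus ` L = L" and "0 \<notin> R \<union> L"
    and "lam = bicay_eigenvalue chi R L T"
    and "M = Gcd_real {lam 2 - lam (2 * k) | k. k \<in> {1..n}}"
    and "M\<^sub>T = Gcd_real {norm (char_sum (chi k) T) | k. k \<in> {1..n}}"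
    \<comment> \<open>\<open>d\<close> is the element from part 0 times the inverse of the element from part 1.\<close>
    and "(u = Inl g\<^sub>p \<and> v = Inr g\<^sub>q \<and> d = g\<^sub>p - g\<^sub>q) \<or>
         (u = Inr g\<^sub>p \<and> v = Inl g\<^sub>q \<and> d = g\<^sub>q - g\<^sub>p)"
  shows "perfect_state_transfer (bicay R L T) u v t \<longleftrightarrow>
     (integral_graph (bicay R L T) \<and> R = L) \<and>
     (\<forall>k\<in>{1..n}.
        (exp (\<i> * of_real (t * (lam 2 - lam (2 * k)))) = 1 \<longrightarrow>
           chi k d = of_real (norm (char_sum (chi k) T)) / char_sum (chi k) T) \<and>
        (exp (\<i> * of_real (t * (lam 2 - lam (2 * k)))) = -1 \<longrightarrow>
           chi k d = - (of_real (norm (char_sum (chi k) T)) / char_sum (chi k) T)) \<and>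
        char_sum (chi k) T \<noteq> 0 \<and>
        v2 (norm (char_sum (chi k) T)) = v2 (real (card T))) \<and>
     (M > 0 \<longrightarrow> v2 (real M) > v2 (real (card T))) \<and>
     t \<in> {(1 + 2 * of_int z) * pi / real (gcd (2 * M\<^sub>T) M) | z::int. True}"
    (is "_ \<longleftrightarrow> (?int \<and> _) \<and> (\<forall>k\<in>_. ?e1 k \<and> ?e2 k \<and> ?nz k \<and> ?v k) \<and> ?M \<and> ?t")
proof -
  note n = assms(1) and one = assms(3) and RL = assms(4,5) and lam = assms(7)
  interpret all_characters chi
    by unfold_locales (use assms(1,2) in simp)
  let ?I = "{1..CARD('a)}"
  have I: "1 \<in> ?I" by (simp add: Suc_le_eq)
  \<comment> \<open>By symmetry of the transfer matrix, \<open>p\<close> can be the element from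
    part 0 in both cases.\<close>
  obtain p q where d: "d = p - q"
    and pst: "perfect_state_transfer (bicay R L T) u v t
      \<longleftrightarrow> perfect_state_transfer (bicay R L T) (Inl p) (Inr q) t" (is "_ \<longleftrightarrow> ?P")
    using assms(10) unfolding perfect_state_transfer_def by (metis transfer_matrix_symmetric)
  \<comment> \<open>Both sides of the claim imply \<open>?INT\<close>, so the equivalence need only
    be proved under it.\<close>
  let ?INT = "R = L \<and> (\<forall>k\<in>?I. ?nz k) \<and>
    (\<forall>k\<in>?I. norm (char_sum (chi k) T) \<in> \<int> \<and> Re (char_sum (chi k) R) \<in> \<int>)"
  have INT_iff: "?INT \<longleftrightarrow> (?int \<and> R = L) \<and> (\<forall>k\<in>?I. ?nz k)"
    using integral_graph_bicay_equal_parts_iff[OF RL(1), of T] by blast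
  have "?P \<longleftrightarrow> (\<forall>k\<in>?I. ?e1 k \<and> ?e2 k \<and> ?v k) \<and> ?M \<and> ?t" if INT: ?INT
  proof -
    define a where "a k = nat \<lfloor>norm (char_sum (chi k) T)\<rfloor>" for k
    define m where "m k = nat \<lfloor>real (card R) + real (card T) -
      (Re (char_sum (chi k) R) + norm (char_sum (chi k) T))\<rfloor>" for k
    have a: "norm (char_sum (chi k) T) = real (a k)" if "k \<in> ?I" for k
      using INT that by (auto simp: a_def elim!: Ints_cases)
    have m: "real (card R) + real (card T) -
        (Re (char_sum (chi k) R) + norm (char_sum (chi k) T)) = real (m k)" if k: "k \<in> ?I" for k
    proof -
      \<comment> \<open>The principal character attains the largest eigenvalue, so the differences
        are nonnegative and \<open>nat\<close> loses nothing.\<close>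
      have "Re (char_sum (chi k) R) \<le> real (card R)" "norm (char_sum (chi k) T) \<le> real (card T)"
        using norm_char_sum_le[OF character_chi[OF k]] complex_Re_le_cmod order_trans by blast+
      moreover have "real (card R) + real (card T) -
        (Re (char_sum (chi k) R) + norm (char_sum (chi k) T)) \<in> \<int>"
        using INT k by (intro Ints_diff Ints_add Ints_of_nat) blast+
      ultimately show ?thesis unfolding m_def by (auto elim!: Ints_cases)
    qed
    have lamk: "lam (2 * k) = Re (char_sum (chi k) R) + norm (char_sum (chi k) T)" for k
      using INT unfolding lam bicay_eigenvalue_even by (simp add: real_sqrt_mult)
    have lam2: "lam 2 = real (card R) + real (card T)"
      using lamk[of 1] by (simp add: one[unfolded One_nat_def])
    have lam_m: "lam 2 - lam (2 * k) = real (m k)" if "k \<in> ?I" for k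
      unfolding lam2 lamk using m[OF that] .
    have "{lam 2 - lam (2 * k) | k. k \<in> {1..n}} = {real (m k) | k. k \<in> ?I}"
      "{norm (char_sum (chi k) T) | k. k \<in> {1..n}} = {real (a k) | k. k \<in> ?I}"
      unfolding n using lam_m a by (auto, metis+)
    then have MM: "M = Gcd (m ` ?I)" "M\<^sub>T = Gcd (a ` ?I)"
      unfolding assms(8,9) by (simp_all only: Gcd_real_image)
    have "?P \<longleftrightarrow> perfect_state_transfer (bicay R R T) (Inl p) (Inr q) t" using INT by simp
    also note bicay_integral_pst_iff[OF RL(1) one _ a m, of p q t, folded MM]
    finally show ?thesis
      using INT lam_m by (auto simp: d)
  qed
  moreover have "?P \<Longrightarrow> ?INT"
    using bicay_pst_integral[OF RL one] I by blast
  ultimately show ?thesis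
    unfolding pst n using INT_iff by blast
qed

end
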